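(* For any hypergraph $\mathcal{H}$ and any integer $r$ with $r\geq 2$, we have $$\chi(\operatorname{KG}^r(\mathcal{H}))\geq \left\lceil \frac{\operatorname{ecd}^r(\mathcal{H})}{r - 1} \right\rceil.$$
   Context: A hypergraph $\mathcal{H}$ is a pair $(V(\mathcal{H}),E(\mathcal{H}))$ where $V(\mathcal{H})$ is a finite set and $E(\mathcal{H})$ is a family (set) of nonempty subsets of $V(\mathcal{H})$. For $N\subseteq V(\mathcal{H})$, the induced subhypergraph $\mathcal{H}[N]$ has vertex set $N$ and edge set $\{e\in E(\mathcal{H}): e\subseteq N\}$. A proper coloring of a hypergraph is an assignment of colors to its vertices such that no edge is monochromatic (so no edge is contained in a color class); the chromatic number $\chi$ is the minimum number of colors in a proper coloring. The general Kneser hypergraph $\operatorname{KG}^r(\mathcal{H})$ has vertex set $E(\mathcal{H})$ and edge set $\{\{e_1,\ldots,e_r\}: e_i\in E(\mathcal{H}),\ e_i\cap e_j=\varnothing \text{ for all } i\neq j\in\{1,\ldots,r\}\}$. An equitable $r$-coloring of a hypergraph is a proper coloring with $r$ color classes (possibly empty) whose sizes pairwise differ by at most one. The equitable $r$-colorability defect $\operatorname{ecd}^r(\mathcal{H})$ is the minimum number of vertices that must be removed from $\mathcal{H}$ so that the induced subhypergraph on the remaining vertices has an equitable $r$-coloring. *)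

theory Defs
  imports Complex_Main
begin

type_synonym 'a hypergraph = "'a set \<times> 'a set set"

abbreviation verts :: "'a hypergraph \<Rightarrow> 'a set" where
  "verts H \<equiv> fst H"

abbreviation edges :: "'a hypergraph \<Rightarrow> 'a set set" where
  "edges H \<equiv> snd H"

definition hypergraph :: "'a hypergraph \<Rightarrow> bool" where
  "hypergraph H \<longleftrightarrow> finite (verts H) \<and> (\<forall>e\<in>edges H. e \<subseteq> verts H \<and> e \<noteq> {})"

definition induced_subhypergraph :: "'a hypergraph \<Rightarrow> 'a set \<Rightarrow> 'a hypergraph" where
  "induced_subhypergraph H N = (N, {e \<in> edges H. e \<subseteq> N})"

definition color_class :: "'a hypergraph \<Rightarrow> ('a \<Rightarrow> nat) \<Rightarrow> nat \<Rightarrow> 'a set" where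
  "color_class H c i = {v \<in> verts H. c v = i}"

text \<open>The colors are \<open>0, \<dots>, k - 1\<close>; some of them may be unused. An edge with a single
  vertex is always monochromatic, so a hypergraph with such an edge has no proper coloring.\<close>

definition proper_coloring :: "'a hypergraph \<Rightarrow> nat \<Rightarrow> ('a \<Rightarrow> nat) \<Rightarrow> bool" where
  "proper_coloring H k c \<longleftrightarrow>
     (\<forall>v\<in>verts H. c v < k) \<and> (\<forall>e\<in>edges H. \<forall>i<k. \<not> e \<subseteq> color_class H c i)"

text \<open>The chromatic number is meaningful only for hypergraphs that have a proper coloring; for the
  Kneser hypergraphs with \<open>r \<ge> 2\<close> this is shown in \<open>kneser_hypergraph_colorable\<close> below.\<close>

definition chromatic_number :: "'a hypergraph \<Rightarrow> nat" where
  "chromatic_number H = (LEAST k. \<exists>c. proper_coloring H k c)"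

definition kneser_hypergraph :: "nat \<Rightarrow> 'a hypergraph \<Rightarrow> 'a set hypergraph" where
  "kneser_hypergraph r H =
     (edges H,
      {e ` {1..r} | e. (\<forall>i\<in>{1..r}. e i \<in> edges H) \<and>
                       (\<forall>i\<in>{1..r}. \<forall>j\<in>{1..r}. i \<noteq> j \<longrightarrow> e i \<inter> e j = {})})"

definition equitable_coloring :: "'a hypergraph \<Rightarrow> nat \<Rightarrow> ('a \<Rightarrow> nat) \<Rightarrow> bool" where
  "equitable_coloring H r c \<longleftrightarrow>
     proper_coloring H r c \<and>
     (\<forall>i<r. \<forall>j<r. \<bar>int (card (color_class H c i)) - int (card (color_class H c j))\<bar> \<le> 1)"

definition ecd :: "nat \<Rightarrow> 'a hypergraph \<Rightarrow> nat" where
  "ecd r H = (LEAST d. \<exists>S \<subseteq> verts H. card S = d \<and>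
     (\<exists>c. equitable_coloring (induced_subhypergraph H (verts H - S)) r c))"

lemma hypergraph_kneser_hypergraph:
  assumes "hypergraph H" "r \<ge> 1"
  shows "hypergraph (kneser_hypergraph r H)"
proof -
  have "edges H \<subseteq> Pow (verts H)" "finite (verts H)"
    using assms(1) by (auto simp: hypergraph_def)
  then have "finite (edges H)"
    using finite_subset by blast
  then show ?thesis
    using assms(2) by (auto simp: hypergraph_def kneser_hypergraph_def)
qed

lemma kneser_hypergraph_colorable:
  assumes H: "hypergraph H" and r: "r \<ge> 2"
  shows "\<exists>k c. proper_coloring (kneser_hypergraph r H) k c"
proof -
  have "finite (edges H)"
    using hypergraph_kneser_hypergraph[OF H] r by (auto simp: hypergraph_def kneser_hypergraph_def)
  then obtain c :: "'a set \<Rightarrow> nat" and k where c: "c ` edges H = {..<k}" "inj_on c (edges H)"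
    using finite_imp_inj_to_nat_seg by (metis lessThan_def)
  have "\<not> e ` {1..r} \<subseteq> color_class (kneser_hypergraph r H) c i"
    if e: "\<forall>i\<in>{1..r}. e i \<in> edges H"
      and dj: "\<forall>i\<in>{1..r}. \<forall>j\<in>{1..r}. i \<noteq> j \<longrightarrow> e i \<inter> e j = {}" for e i
  proof
    assume "e ` {1..r} \<subseteq> color_class (kneser_hypergraph r H) c i"
    moreover have mem: "1 \<in> {1..r}" "2 \<in> {1..r}"
      using r by auto
    ultimately have "c (e 1) = c (e 2)"
      by (auto simp: color_class_def image_subset_iff)
    then have "e 1 = e 2"
      using c(2) e mem by (auto dest: inj_onD)
    moreover have "e 1 \<inter> e 2 = {}"
      using dj mem by simp
    ultimately show False
      using H e mem by (auto simp: hypergraph_def)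
  qed
  then have "proper_coloring (kneser_hypergraph r H) k c"
    using c(1) unfolding proper_coloring_def by (auto simp: kneser_hypergraph_def)
  then show ?thesis
    by blast
qed

lemma ecd_attained:
  assumes "hypergraph H"
  shows "\<exists>S \<subseteq> verts H. card S = ecd r H \<and>
     (\<exists>c. equitable_coloring (induced_subhypergraph H (verts H - S)) r c)"
proof -
  have "equitable_coloring (induced_subhypergraph H (verts H - verts H)) r (\<lambda>_. 0)"
    using assms by (auto simp: equitable_coloring_def proper_coloring_def
        induced_subhypergraph_def color_class_def hypergraph_def)
  then have "\<exists>d. \<exists>S \<subseteq> verts H. card S = d \<and>
     (\<exists>c. equitable_coloring (induced_subhypergraph H (verts H - S)) r c)"
    by blast
  then show ?thesis
    unfolding ecd_def by (rule LeastI_ex)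
qed

end

theory Submission
  imports Defs "HOL-Number_Theory.Cong" "HOL-Library.Disjoint_Sets"
begin

text \<open>For a prime \<open>p\<close>, consider the nonempty partial maps \<open>X\<close> from the \<open>n\<close> vertices to the signs
  \<open>\<int>/p\<close>, ordered by extension. A Tucker-type lemma says that every \<open>\<int>/p\<close>-equivariant labelling
  of them by signs has a chain \<open>X\<^sub>1 \<subset> \<dots> \<subset> X\<^sub>n\<close> on which consecutive labels differ: with the
  standard resolution chains \<open>c\<^sub>k\<close> of the order complex, \<open>\<partial>c\<^sub>k = D\<^sub>k c\<^sub>k\<^sub>-\<^sub>1\<close> where \<open>D\<^sub>k\<close> is
  \<open>g - 1\<close> or \<open>1 + g + \<dots> + g\<^bsup>p-1\<^esup>\<close>, and the cochains that represent the generators of the cohomology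
  of \<open>\<int>/p\<close> vanish on words with equal neighbours, but, summed over the
  translates under \<open>\<int>/p\<close>, evaluate to 1 modulo \<open>p\<close> on \<open>c\<^sub>k\<close>.

  Given a colouring of the Kneser hypergraph with \<open>k\<close> colours, label \<open>X\<close> according to the signs of its
  large classes if its largest equitable restriction has at most \<open>n - ecd\<close> vertices, and otherwise
  according to the set of pairs (sign, colour) for which the sign class contains an edge of that
  colour. Along a chain the label can change at most \<open>n - ecd\<close> times in the first regime and
  \<open>(p - 1) k\<close> times in the second, so \<open>n \<le> n - ecd + (p - 1) k\<close>.

  If the bound holds for \<open>a\<close> and \<open>b\<close>, it holds for \<open>a b\<close>: apply it for \<open>a\<close> to the hypergraph of all
  \<open>N\<close> for which the defect \<open>ecd\<^sup>b\<close> of \<open>H[N]\<close> exceeds \<open>(b - 1) k\<close>. Each such \<open>N\<close> contains \<open>b\<close>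
  disjoint edges of the same colour, which becomes the colour of \<open>N\<close>.\<close>

subsection \<open>Chains of signed sets\<close>

text \<open>The alternating sum of \<open>w\<close> over the words with one letter deleted. Empty
  words are kept, so the complex is augmented: \<open>coboundary w [a] = w []\<close>.\<close>

fun coboundary :: "('b list \<Rightarrow> int) \<Rightarrow> 'b list \<Rightarrow> int" where
  "coboundary w [] = 0"
| "coboundary w (a # x) = w x - coboundary (\<lambda>y. w (a # y)) x"

text \<open>Dual of the prism operator: an alternating sum over the positions at which
  \<open>x\<close> turns into \<open>map f x\<close>, with both \<open>a\<close> and
  \<open>f a\<close> listed at the turn. It is a homotopy between the identity and
  \<open>map f\<close>.\<close>

fun prism :: "('b \<Rightarrow> 'b) \<Rightarrow> ('b list \<Rightarrow> int) \<Rightarrow> 'b list \<Rightarrow> int" where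
  "prism f w [] = 0"
| "prism f w (a # x) = w (a # f a # map f x) - prism f (\<lambda>y. w (a # y)) x"

text \<open>Dual to the contraction that moves a chain by \<open>f\<close> and then cones it off from \<open>b\<close>.\<close>

definition cone :: "('b \<Rightarrow> 'b) \<Rightarrow> 'b \<Rightarrow> ('b list \<Rightarrow> int) \<Rightarrow> 'b list \<Rightarrow> int" where
  "cone f b w x = w (b # map f x) - prism f w x"

lemma coboundary_diff:
  "coboundary (\<lambda>y. w y - w' y) x = coboundary w x - coboundary w' x"
  by (induction x arbitrary: w w') simp_all

lemma coboundary_mult:
  "coboundary (\<lambda>y. k * w y) x = k * coboundary w x"
  by (induction x arbitrary: w) (simp_all add: right_diff_distrib)

lemma coboundary_sum:
  "coboundary (\<lambda>y. \<Sum>i\<in>I. w i y) x = (\<Sum>i\<in>I. coboundary (w i) x)"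
  by (induction x arbitrary: w) (simp_all add: sum_subtractf)

lemma coboundary_map:
  "coboundary (\<lambda>y. w (map g y)) x = coboundary w (map g x)"
  by (induction x arbitrary: w) simp_all

lemma prism_diff:
  "prism f (\<lambda>y. w y - w' y) x = prism f w x - prism f w' x"
  by (induction x arbitrary: w w') simp_all

lemma prism_coboundary:
  "prism f (coboundary w) x = w (map f x) - w x - coboundary (prism f w) x"
proof (induction x arbitrary: w)
  case (Cons a x)
  show ?case
    using Cons.IH[of "\<lambda>y. w (a # y)"]
    by (simp add: prism_diff coboundary_diff
        coboundary_map[of "\<lambda>y. w (a # f a # y)" f x])
qed simp

text \<open>Deleting \<open>b\<close> from the coned word gives \<open>w (map f x)\<close>, which
  cancels one end of the prism homotopy. Thanks to the augmentation no correction appears for short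
  words.\<close>

lemma cone_coboundary:
  "cone f b (coboundary w) = (\<lambda>x. w x - coboundary (cone f b w) x)"
proof
  fix x
  have "cone f b w = (\<lambda>y. w (b # map f y) - prism f w y)"
    by (simp add: cone_def fun_eq_iff)
  then have "coboundary (cone f b w) x = coboundary (\<lambda>y. w (b # y)) (map f x) - coboundary (prism f w) x"
    by (simp add: coboundary_diff coboundary_map[of "\<lambda>y. w (b # y)" f x])
  then show "cone f b (coboundary w) x = w x - coboundary (cone f b w) x"
    by (simp add: cone_def[of f b "coboundary w"] prism_coboundary)
qed

lemma prism_cong:
  assumes "\<And>y a z. x = y @ a # z \<Longrightarrow> w (y @ a # f a # map f z) = w' (y @ a # f a # map f z)"
  shows "prism f w x = prism f w' x"
  using assms
proof (induction x arbitrary: w w')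
  case (Cons b x)
  have "w (b # f b # map f x) = w' (b # f b # map f x)"
    using Cons.prems[of "[]" b x] by simp
  moreover have "prism f (\<lambda>y. w (b # y)) x = prism f (\<lambda>y. w' (b # y)) x"
  proof (rule Cons.IH)
    fix y a z assume "x = y @ a # z"
    then show "w (b # y @ a # f a # map f z) = w' (b # y @ a # f a # map f z)"
      using Cons.prems[of "b # y" a z] by simp
  qed
  ultimately show ?case by simp
qed simp

text \<open>Precomposition with the differentials of the minimal resolution of a cyclic group of order \<open>p\<close>
  generated by \<open>g\<close>; the case \<open>k = 0\<close> is the bottom of the recursion for \<open>flag_sum\<close>.\<close>

definition cyclic_diff :: "('b \<Rightarrow> 'b) \<Rightarrow> nat \<Rightarrow> nat \<Rightarrow> ('b list \<Rightarrow> int) \<Rightarrow> 'b list \<Rightarrow> int" where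
  "cyclic_diff g p k w x =
     (if k = 0 then w x
      else if odd k then w (map g x) - w x
      else \<Sum>i<p. w (map (g ^^ i) x))"

lemma cyclic_diff_coboundary:
  "cyclic_diff g p k (coboundary w) = coboundary (cyclic_diff g p k w)"
proof
  fix x
  have "cyclic_diff g p k w = (if k = 0 then w else if odd k then (\<lambda>x. w (map g x) - w x)
     else (\<lambda>x. \<Sum>i<p. w (map (g ^^ i) x)))"
    by (auto simp: cyclic_diff_def fun_eq_iff)
  then show "cyclic_diff g p k (coboundary w) x = coboundary (cyclic_diff g p k w) x"
    by (auto simp: cyclic_diff_def coboundary_diff coboundary_sum coboundary_map)
qed

lemma cyclic_diff_minus:
  "cyclic_diff g p k (\<lambda>x. w x - w' x) = (\<lambda>x. cyclic_diff g p k w x - cyclic_diff g p k w' x)"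
  by (auto simp: cyclic_diff_def fun_eq_iff sum_subtractf)

text \<open>Both composites of \<open>g - 1\<close> with the norm vanish: the sum over the orbit is
  invariant under \<open>g\<close>, since its terms for \<open>i = 0\<close> and
  \<open>i = p\<close> agree.\<close>

lemma cyclic_diff_cyclic_diff:
  assumes "k > 0" "map (g ^^ p) x = x"
  shows "cyclic_diff g p k (cyclic_diff g p (Suc k) w) x = 0"
proof -
  have eq: "(\<Sum>i<p. w (map (g ^^ Suc i) x)) = (\<Sum>i<p. w (map (g ^^ i) x))"
    using assms(2) sum.lessThan_Suc_shift[of "\<lambda>i. w (map (g ^^ i) x)" p]
    by simp
  show ?thesis
  proof (cases "odd k")
    case True
    have "map (g ^^ i) (map g x) = map (g ^^ Suc i) x" for i
      by (simp add: funpow_swap1)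
    then show ?thesis
      using True assms(1) eq by (simp add: cyclic_diff_def del: map_map)
  next
    case False
    have "map g (map (g ^^ i) x) = map (g ^^ Suc i) x" for i
      by simp
    then show ?thesis
      using False assms(1) eq by (simp add: cyclic_diff_def sum_subtractf del: map_map)
  qed
qed

section \<open>The cyclic group acting on signed sets and flags\<close>

definition shift :: "nat \<Rightarrow> nat \<Rightarrow> nat" where
  "shift p a = Suc a mod p"

definition rotate_map :: "nat \<Rightarrow> ('a \<rightharpoonup> nat) \<Rightarrow> ('a \<rightharpoonup> nat)" where
  "rotate_map p X = (\<lambda>v. map_option (shift p) (X v))"

definition signed_sets :: "nat \<Rightarrow> 'a set \<Rightarrow> ('a \<rightharpoonup> nat) set" where
  "signed_sets p V = {X. X \<noteq> Map.empty \<and> dom X \<subseteq> V \<and> ran X \<subseteq> {..<p}}"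

text \<open>Repetitions are allowed; a labelling with distinct neighbours excludes them.\<close>

definition flags :: "nat \<Rightarrow> 'a set \<Rightarrow> ('a \<rightharpoonup> nat) list set" where
  "flags p V = {x. length x = card V \<and> sorted_wrt (\<subseteq>\<^sub>m) x \<and> set x \<subseteq> signed_sets p V}"

text \<open>Chains are represented by the linear functionals they induce on cochains. If \<open>vs\<close> has \<open>k + 1\<close>
  elements, \<open>flag_sum p vs\<close> is the chain \<open>c\<^sub>k\<close> in the order complex of the signed sets on \<open>vs\<close>:
  \<open>D\<^sub>k c\<^sub>k\<^sub>-\<^sub>1\<close> coned off by adding the new vertex with sign 0.\<close>

fun flag_sum :: "nat \<Rightarrow> 'a list \<Rightarrow> (('a \<rightharpoonup> nat) list \<Rightarrow> int) \<Rightarrow> int" where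
  "flag_sum p [] w = w []"
| "flag_sum p (v # vs) w =
     flag_sum p vs (cyclic_diff (rotate_map p) p (length vs) (cone (\<lambda>X. X(v \<mapsto> 0)) [v \<mapsto> 0] w))"

lemma shift_funpow: "a < p \<Longrightarrow> (shift p ^^ i) a = (a + i) mod p"
  by (induction i) (simp_all add: shift_def mod_Suc_eq)

lemma shift_less: "a < p \<Longrightarrow> shift p a < p"
  by (auto simp: shift_def)

lemma rotate_map_funpow: "(rotate_map p ^^ i) X v = map_option (shift p ^^ i) (X v)"
  by (induction i) (simp_all add: rotate_map_def option.map_comp comp_def option.map_id0 option.map_ident)

lemma rotate_map_signed_sets:
  assumes "X \<in> signed_sets p V" shows "rotate_map p X \<in> signed_sets p V"
proof -
  have "ran (rotate_map p X) \<subseteq> {..<p}"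
    using assms by (force simp: signed_sets_def rotate_map_def ran_def shift_less)
  moreover have "dom (rotate_map p X) = dom X"
    by (auto simp: rotate_map_def dom_def)
  ultimately show ?thesis
    using assms by (simp add: signed_sets_def flip: dom_eq_empty_conv)
qed

lemma rotate_map_funpow_signed_sets:
  "X \<in> signed_sets p V \<Longrightarrow> (rotate_map p ^^ i) X \<in> signed_sets p V"
  by (induction i) (auto simp: rotate_map_signed_sets)

lemma rotate_map_funpow_self:
  assumes "X \<in> signed_sets p V" shows "(rotate_map p ^^ p) X = X"
proof
  fix v
  show "(rotate_map p ^^ p) X v = X v"
  proof (cases "X v")
    case (Some a)
    then have "a < p"
      using assms by (auto simp: signed_sets_def ran_def)
    then show ?thesis
      using Some by (simp add: rotate_map_funpow shift_funpow)
  qed (simp add: rotate_map_funpow)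
qed

lemma map_rotate_map_flags:
  assumes "x \<in> flags p V" shows "map (rotate_map p ^^ i) x \<in> flags p V"
proof -
  have "X \<subseteq>\<^sub>m Y \<Longrightarrow> (rotate_map p ^^ i) X \<subseteq>\<^sub>m (rotate_map p ^^ i) Y" for X Y :: "'a \<rightharpoonup> nat"
    by (force simp: map_le_def rotate_map_funpow dom_def)
  then have "sorted_wrt (\<subseteq>\<^sub>m) (map (rotate_map p ^^ i) x)"
    using assms unfolding sorted_wrt_map flags_def
    by (auto elim: sorted_wrt_mono_rel[rotated])
  then show ?thesis
    using assms by (auto simp: flags_def rotate_map_funpow_signed_sets)
qed

text \<open>Both \<open>X\<close> and \<open>[v \<mapsto> 0]\<close> lie below
  \<open>X(v \<mapsto> 0)\<close>, so every word at which the cone evaluates \<open>w\<close> is a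
  flag on \<open>insert v V\<close>, one longer than \<open>x\<close>.\<close>

lemma cone_cong_flags:
  assumes V: "finite V" "v \<notin> V" and "p > 0" and x: "x \<in> flags p V"
    and w: "\<And>x. x \<in> flags p (insert v V) \<Longrightarrow> w x = w' x"
  shows "cone (\<lambda>X. X(v \<mapsto> 0)) [v \<mapsto> 0] w x = cone (\<lambda>X. X(v \<mapsto> 0)) [v \<mapsto> 0] w' x"
proof -
  let ?f = "\<lambda>X :: 'a \<rightharpoonup> nat. X(v \<mapsto> 0)"
  have nv: "v \<notin> dom X" if "X \<in> signed_sets p V" for X
    using that V by (auto simp: signed_sets_def)
  have up: "X(v \<mapsto> 0) \<in> signed_sets p (insert v V)" if "X \<in> signed_sets p V" for X
    using that \<open>p > 0\<close> by (auto simp: signed_sets_def ran_def split: if_splits)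
  have incl: "X \<in> signed_sets p (insert v V)" if "X \<in> signed_sets p V" for X
    using that by (auto simp: signed_sets_def)
  have le: "X \<subseteq>\<^sub>m X(v \<mapsto> 0)" if "X \<in> signed_sets p V" for X
    using nv[OF that] by (auto simp: map_le_def)
  have mono: "X(v \<mapsto> 0) \<subseteq>\<^sub>m Y(v \<mapsto> 0)" if "X \<subseteq>\<^sub>m Y" for X Y :: "'a \<rightharpoonup> nat"
    using that by (auto simp: map_le_def)
  have v0: "[v \<mapsto> 0] \<in> signed_sets p (insert v V)"
    using \<open>p > 0\<close> by (auto simp: signed_sets_def)
  have sorted_f: "sorted_wrt (\<subseteq>\<^sub>m) (map ?f z)" if "sorted_wrt (\<subseteq>\<^sub>m) z" for z
    using that mono unfolding sorted_wrt_map by (auto elim: sorted_wrt_mono_rel[rotated])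
  have xs: "set x \<subseteq> signed_sets p V" "sorted_wrt (\<subseteq>\<^sub>m) x" "length x = card V"
    using x by (auto simp: flags_def)
  have c: "card (insert v V) = Suc (card V)"
    using V by simp
  have "[v \<mapsto> 0] # map ?f x \<in> flags p (insert v V)"
    using xs up v0 sorted_f by (auto simp: flags_def c map_le_def)
  moreover have "prism ?f w x = prism ?f w' x"
  proof (rule prism_cong, rule w)
    fix y a z assume e: "x = y @ a # z"
    have ss: "set (y @ a # z) \<subseteq> signed_sets p V" "sorted_wrt (\<subseteq>\<^sub>m) (y @ a # z)"
      using xs by (simp_all add: e)
    have tr: "X \<subseteq>\<^sub>m Y(v \<mapsto> 0)" if "X \<subseteq>\<^sub>m Y" "Y \<in> signed_sets p V" for X Y
      using that le map_le_trans by blast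
    have "sorted_wrt (\<subseteq>\<^sub>m) (y @ a # ?f a # map ?f z)"
      using ss sorted_f[of "a # z"] by (auto simp: sorted_wrt_append tr le)
    then show "y @ a # ?f a # map ?f z \<in> flags p (insert v V)"
      using ss xs(3) incl up by (auto simp: flags_def c e)
  qed
  ultimately show ?thesis
    by (simp add: cone_def w)
qed

lemma cyclic_diff_cong:
  assumes "w x = w' x" "w (map g x) = w' (map g x)"
    "\<And>i. w (map (g ^^ i) x) = w' (map (g ^^ i) x)"
  shows "cyclic_diff g p k w x = cyclic_diff g p k w' x"
  using assms by (simp add: cyclic_diff_def)

text \<open>The chain behind \<open>flag_sum p vs\<close> is supported on flags, so a nonzero value
  exhibits a flag.\<close>

lemma flag_sum_cong:
  assumes "distinct vs" "p > 0" "\<And>x. x \<in> flags p (set vs) \<Longrightarrow> w x = w' x"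
  shows "flag_sum p vs w = flag_sum p vs w'"
  using assms
proof (induction vs arbitrary: w w')
  case (Cons v vs)
  let ?c = "cone (\<lambda>X. X(v \<mapsto> 0)) [v \<mapsto> 0]"
  have "?c w x = ?c w' x" if "x \<in> flags p (set vs)" for x
    using Cons.prems that by (intro cone_cong_flags[of "set vs"]) auto
  then have "cyclic_diff (rotate_map p) p (length vs) (?c w) x
      = cyclic_diff (rotate_map p) p (length vs) (?c w') x" if "x \<in> flags p (set vs)" for x
    using that map_rotate_map_flags[OF that] map_rotate_map_flags[OF that, of 1]
    by (intro cyclic_diff_cong) auto
  then show ?case
    using Cons.prems by (auto intro: Cons.IH)
qed (simp add: flags_def)

lemma cone_diff: "cone f b (\<lambda>x. w x - w' x) = (\<lambda>x. cone f b w x - cone f b w' x)"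
  by (simp add: cone_def prism_diff fun_eq_iff)

lemma flag_sum_diff: "flag_sum p vs (\<lambda>x. w x - w' x) = flag_sum p vs w - flag_sum p vs w'"
  by (induction vs arbitrary: w w') (simp_all add: cone_diff cyclic_diff_minus)

lemma flag_sum_zero: "flag_sum p vs (\<lambda>x. 0) = 0"
  using flag_sum_diff[of p vs "\<lambda>x. 0" "\<lambda>x. 0"] by simp

lemma flag_sum_add: "flag_sum p vs (\<lambda>x. w x + w' x) = flag_sum p vs w + flag_sum p vs w'"
  using flag_sum_diff[of p vs w "\<lambda>x. 0 - w' x"] flag_sum_diff[of p vs "\<lambda>x. 0" w']
  by (simp add: flag_sum_zero)

lemma flag_sum_sum:
  "finite I \<Longrightarrow> flag_sum p vs (\<lambda>x. \<Sum>i\<in>I. w i x) = (\<Sum>i\<in>I. flag_sum p vs (w i))"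
  by (induction I rule: finite_induct) (simp_all add: flag_sum_zero flag_sum_add)

text \<open>Dual form of \<open>\<partial>c\<^sub>k = D\<^sub>k c\<^sub>k\<^sub>-\<^sub>1\<close>.
  The cone turns \<open>coboundary w\<close> into \<open>w\<close> minus the coboundary of a cone.
  Differentials commute with coboundaries, so by induction the second term meets two consecutive
  differentials and vanishes.\<close>

lemma flag_sum_coboundary:
  assumes "distinct (v # vs)" "p > 0"
  shows "flag_sum p (v # vs) (coboundary w) =
    flag_sum p vs (cyclic_diff (rotate_map p) p (length vs) w)"
  using assms
proof (induction vs arbitrary: v w)
  case Nil
  then show ?case
    by (simp add: cyclic_diff_def cone_coboundary)
next
  case (Cons u vs)
  let ?D = "cyclic_diff (rotate_map p) p"
  let ?c = "cone (\<lambda>X. X(v \<mapsto> 0)) [v \<mapsto> 0] w"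
  have "flag_sum p (u # vs) (coboundary (?D (Suc (length vs)) ?c))
      = flag_sum p vs (?D (length vs) (?D (Suc (length vs)) ?c))"
    using Cons.prems by (intro Cons.IH) auto
  also have "\<dots> = 0"
  proof (cases vs)
    \<comment> \<open>Here the outer differential is the identity, but \<open>flag_sum p []\<close>
      evaluates at the empty word, where \<open>g - 1\<close> gives zero.\<close>
    case Nil
    then show ?thesis
      by (simp add: cyclic_diff_def)
  next
    case (Cons u' us)
    have "?D (length vs) (?D (Suc (length vs)) ?c) x = 0" if "x \<in> flags p (set vs)" for x
    proof (rule cyclic_diff_cyclic_diff)
      show "map (rotate_map p ^^ p) x = x"
        using that by (intro map_idI) (auto simp: flags_def dest: rotate_map_funpow_self)
    qed (simp add: Cons)
    then have "flag_sum p vs (?D (length vs) (?D (Suc (length vs)) ?c)) = flag_sum p vs (\<lambda>x. 0)"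
      using \<open>distinct (v # u # vs)\<close> \<open>p > 0\<close> by (intro flag_sum_cong) auto
    then show ?thesis
      by (simp add: flag_sum_zero)
  qed
  finally have "flag_sum p (u # vs) (coboundary (?D (Suc (length vs)) ?c)) = 0" .
  then show ?case
    by (simp add: cone_coboundary cyclic_diff_minus cyclic_diff_coboundary
        flag_sum_diff cone_diff del: flag_sum.simps(2) add: flag_sum.simps(2)[of p v])
qed

section \<open>Cochains on words of signs\<close>

definition carry :: "nat \<Rightarrow> nat \<Rightarrow> nat \<Rightarrow> int" where
  "carry a b c = of_bool (c < b) - of_bool (c < a) + of_bool (b < a)"

text \<open>\<open>carry\<close> is the coboundary of the descent cochain \<open>[a, b] \<mapsto> of_bool (b < a)\<close>, and
  \<open>word_cochain\<close> is the cup product of powers of \<open>carry\<close> with a cochain of degree 0 or 1. The value at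
  \<open>[]\<close> makes \<open>coboundary_word_cochain\<close> hold for words of length 1.\<close>

fun word_cochain :: "nat \<Rightarrow> nat list \<Rightarrow> int" where
  "word_cochain p [] = 1"
| "word_cochain p [a] = of_bool (Suc a = p)"
| "word_cochain p [a, b] = of_bool (b < a)"
| "word_cochain p (a # b # c # x) = carry a b c * word_cochain p (c # x)"

text \<open>For letters below \<open>p\<close>, \<open>carry a b c\<close> is the carry when the
  residues of \<open>b - a\<close> and \<open>c - b\<close> modulo \<open>p\<close> are added, and
  rotation preserves these residues.\<close>

lemma carry_shift:
  assumes "a < p" "b < p" "c < p"
  shows "carry (shift p a) (shift p b) (shift p c) = carry a b c"
  using assms by (auto simp: carry_def shift_def mod_Suc split: if_splits)

text \<open>Leibniz rule: \<open>carry\<close> is a cocycle of even degree, so the coboundary passes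
  to the other factor of the cup product.\<close>

lemma coboundary_word_cochain_Cons:
  "coboundary (word_cochain p) (a # b # c # x) = carry a b c * coboundary (word_cochain p) (c # x)"
proof (cases x)
  case Nil
  then show ?thesis
    by (simp add: carry_def)
next
  case (Cons d y)
  have "carry b c d * u - (carry a c d * u - (carry a b d * u - carry a b c * t)) = carry a b c * (u - t)" for u t
    by (simp add: carry_def algebra_simps)
  then show ?thesis
    by (simp add: Cons coboundary_mult)
qed

lemma word_cochain_map_shift:
  assumes "set (a # b # c # x) \<subseteq> {..<p}"
  shows "word_cochain p (map (shift p ^^ i) (a # b # c # x)) =
    carry a b c * word_cochain p (map (shift p ^^ i) (c # x))"
proof -
  have "(shift p ^^ i) a < p \<and> (shift p ^^ i) b < p \<and> (shift p ^^ i) c < p \<and>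
     carry ((shift p ^^ i) a) ((shift p ^^ i) b) ((shift p ^^ i) c) = carry a b c"
    using assms by (induction i) (auto simp: carry_shift shift_less)
  then show ?thesis
    by simp
qed

text \<open>The cochains follow the same alternation of norm and \<open>g - 1\<close> as the chains.
  For one letter, exactly one rotation reaches \<open>p - 1\<close>; for two, a rotation changes a
  descent only when \<open>p - 1\<close> wraps to 0; from longer words an invariant factor
  \<open>carry\<close> splits off.\<close>

lemma coboundary_word_cochain:
  assumes "set x \<subseteq> {..<p}" "p > 0"
  shows "coboundary (word_cochain p) x =
    (if odd (length x) then \<Sum>i<p. word_cochain p (map (shift p ^^ i) x)
     else word_cochain p (map (shift p) x) - word_cochain p x)"
  using assms
proof (induction p x rule: word_cochain.induct)
  case (2 p a)
  have "(\<Sum>i<p. of_bool (Suc ((a + i) mod p) = p)) = (\<Sum>i<p. of_bool (i = p - Suc a) :: int)"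
  proof (rule sum.cong)
    fix i assume "i \<in> {..<p}"
    then have "i < p" "a < p" using 2 by auto
    then have "(Suc ((a + i) mod p) = p) = (i = p - Suc a)"
      by (cases "a + i < p") (auto simp: le_mod_geq)
    then show "of_bool (Suc ((a + i) mod p) = p) = (of_bool (i = p - Suc a) :: int)"
      by simp
  qed simp
  also have "\<dots> = 1"
    using 2 by (simp add: of_bool_def sum.delta)
  finally show ?case
    using 2 by (simp add: shift_funpow)
next
  case (3 p a b)
  then show ?case
    by (auto simp: shift_def mod_Suc split: if_splits)
next
  case (4 p a b c x)
  have IH: "coboundary (word_cochain p) (c # x) =
    (if odd (length (c # x)) then \<Sum>i<p. word_cochain p (map (shift p ^^ i) (c # x))
     else word_cochain p (map (shift p) (c # x)) - word_cochain p (c # x))"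
    using 4 by auto
  have s: "word_cochain p (map (shift p ^^ i) (a # b # c # x)) =
    carry a b c * word_cochain p (map (shift p ^^ i) (c # x))" for i
    using 4 by (intro word_cochain_map_shift) auto
  let ?y = "a # b # c # x"
  have s1: "word_cochain p (map (shift p) ?y) = carry a b c * word_cochain p (map (shift p) (c # x))"
    using s[of 1] by simp
  have s0: "word_cochain p ?y = carry a b c * word_cochain p (c # x)"
    by simp
  have "odd (length ?y) = odd (length (c # x))"
    by simp
  then show ?case
    unfolding coboundary_word_cochain_Cons IH s s1 s0
    by (simp only: sum_distrib_left right_diff_distrib split: if_split) blast
qed auto

text \<open>A descent has unequal letters, and \<open>carry a b c\<close> is zero if
  \<open>a = b\<close> or \<open>b = c\<close>.\<close>

lemma distinct_adj_if_word_cochain: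
  "word_cochain p x \<noteq> 0 \<Longrightarrow> distinct_adj x"
  by (induction p x rule: word_cochain.induct) (auto simp: carry_def split: if_splits)

subsection \<open>Equivariant labellings\<close>

lemma sum_cong_mod_if_increments_eq:
  fixes f h :: "nat \<Rightarrow> int"
  assumes "\<And>i. f (Suc i) - f i = h (Suc i) - h i"
  shows "[(\<Sum>i<p. f i) = (\<Sum>i<p. h i)] (mod int p)"
proof -
  define d where "d = f 0 - h 0"
  have "f i = h i + d" for i
  proof (induction i)
    case (Suc i)
    then show ?case using assms[of i] by simp
  qed (simp add: d_def)
  then have "(\<Sum>i<p. f i) = (\<Sum>i<p. h i) + int p * d"
    by (simp add: sum.distrib)
  then show ?thesis
    by (simp add: cong_def)
qed

definition equivariant_label :: "nat \<Rightarrow> 'a set \<Rightarrow> (('a \<rightharpoonup> nat) \<Rightarrow> nat) \<Rightarrow> bool" where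
  "equivariant_label p V s \<longleftrightarrow>
     (\<forall>X \<in> signed_sets p V. s X < p \<and> s (rotate_map p X) = shift p (s X))"

lemma equivariant_label_funpow:
  assumes "equivariant_label p V s" "X \<in> signed_sets p V"
  shows "s ((rotate_map p ^^ i) X) = (shift p ^^ i) (s X)"
  using assms by (induction i) (auto simp: equivariant_label_def rotate_map_funpow_signed_sets)

text \<open>The inductive step transfers \<open>\<partial>c\<^sub>k = D\<^sub>k c\<^sub>k\<^sub>-\<^sub>1\<close> through
  \<open>coboundary_word_cochain\<close>. For odd \<open>k\<close> it only controls the increments in \<open>i\<close>, so the sum
  over the group is preserved modulo \<open>p\<close> only.\<close>

lemma flag_sum_word_cochain:
  assumes "equivariant_label p V s" "p > 0" "distinct vs" "set vs \<subseteq> V" "vs \<noteq> []"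
  shows "[(\<Sum>i<p. flag_sum p vs (\<lambda>x. word_cochain p (map s (map (rotate_map p ^^ i) x)))) = 1] (mod int p)"
  using assms(3-5)
proof (induction vs)
  case (Cons v us)
  define w where "w = (\<lambda>i x. word_cochain p (map s (map (rotate_map p ^^ i) x)))"
  have flags_mem: "X \<in> signed_sets p V" if "x \<in> flags p (set vs)" "set vs \<subseteq> V" "X \<in> set x" for x vs X
    using that by (auto simp: flags_def signed_sets_def)
  have map_s: "map s (map (rotate_map p ^^ i) x) = map (shift p ^^ i) (map s x)"
    if "x \<in> flags p (set vs)" "set vs \<subseteq> V" for x i vs
    using flags_mem[OF that] equivariant_label_funpow[OF assms(1)] by simp
  have less: "set (map s x) \<subseteq> {..<p}" if "x \<in> flags p (set vs)" "set vs \<subseteq> V" for x vs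
    using flags_mem[OF that] assms(1) by (auto simp: equivariant_label_def)
  have rot: "map (rotate_map p ^^ i) (map (rotate_map p) x) = map (rotate_map p ^^ Suc i) x" for i x
    by (simp add: funpow_swap1)
  have "coboundary (w i) x = coboundary (word_cochain p) (map s (map (rotate_map p ^^ i) x))" for i x
    using coboundary_map[of "word_cochain p" "s \<circ> (rotate_map p ^^ i)" x] by (simp add: w_def comp_assoc)
  then have cob: "coboundary (w i) x =
    (if odd (length x) then \<Sum>j<p. word_cochain p (map (shift p ^^ j) (map s (map (rotate_map p ^^ i) x)))
     else word_cochain p (map (shift p) (map s (map (rotate_map p ^^ i) x))) - w i x)"
    if "x \<in> flags p (set (v # us))" for i x
    using coboundary_word_cochain[OF less[OF map_rotate_map_flags[OF that, of i]] assms(2)] Cons.prems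
    by (auto simp: w_def)
  have len: "length x = Suc (length us)" if "x \<in> flags p (set (v # us))" for x
    using that Cons.prems by (simp add: flags_def distinct_card)
  let ?D = "cyclic_diff (rotate_map p) p (length us)"
  have D: "flag_sum p (v # us) (coboundary (w i)) = flag_sum p us (?D (w i))" for i
    using Cons.prems assms(2) by (intro flag_sum_coboundary) auto
  have "[(\<Sum>i<p. flag_sum p (v # us) (w i)) = 1] (mod int p)"
  proof (cases "odd (length us)")
    \<comment> \<open>Chains and cochains both involve \<open>g - 1\<close> here, so evaluating
      \<open>coboundary (w i)\<close> in two ways equates increments in \<open>i\<close>.\<close>
    case True
    have "flag_sum p (v # us) (w (Suc i)) - flag_sum p (v # us) (w i)
        = flag_sum p us (w (Suc i)) - flag_sum p us (w i)" for i
    proof -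
      have "coboundary (w i) x = w (Suc i) x - w i x" if "x \<in> flags p (set (v # us))" for x
      proof -
        have "map (shift p) (map s (map (rotate_map p ^^ i) x)) = map s (map (rotate_map p ^^ Suc i) x)"
          using map_s[OF map_rotate_map_flags[OF that, of i], of 1] Cons.prems by simp
        then show ?thesis
          using cob[OF that, of i] len[OF that] True by (simp only: w_def even_Suc if_False) simp
      qed
      then have "flag_sum p (v # us) (coboundary (w i)) = flag_sum p (v # us) (\<lambda>x. w (Suc i) x - w i x)"
        using Cons.prems assms(2) by (intro flag_sum_cong) auto
      moreover have "?D (w i) = (\<lambda>x. w (Suc i) x - w i x)"
        using True odd_pos[OF True]
        by (intro ext) (simp add: cyclic_diff_def w_def rot del: map_map funpow.simps)
      ultimately show ?thesis
        using D[of i] by (simp only: flag_sum_diff)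
    qed
    then have "[(\<Sum>i<p. flag_sum p (v # us) (w i)) = (\<Sum>i<p. flag_sum p us (w i))] (mod int p)"
      by (rule sum_cong_mod_if_increments_eq)
    moreover have "[(\<Sum>i<p. flag_sum p us (w i)) = 1] (mod int p)"
      unfolding w_def using Cons.prems True by (intro Cons.IH) auto
    ultimately show ?thesis
      using cong_trans by blast
  next
    \<comment> \<open>Both sides now involve the norm, so a single coboundary equates the two sums
      exactly.\<close>
    case False
    have "coboundary (w 0) x = (\<Sum>i<p. w i x)" if "x \<in> flags p (set (v # us))" for x
    proof -
      have "w i x = word_cochain p (map (shift p ^^ i) (map s x))" for i
        unfolding w_def using map_s[OF that Cons.prems(2)] by (rule arg_cong)
      then show ?thesis
        using cob[OF that, of 0] len[OF that] False by simp
    qed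
    then have "flag_sum p (v # us) (coboundary (w 0)) = flag_sum p (v # us) (\<lambda>x. \<Sum>i<p. w i x)"
      using Cons.prems assms(2) by (intro flag_sum_cong) auto
    then have eq: "(\<Sum>i<p. flag_sum p (v # us) (w i)) = flag_sum p us (?D (w 0))"
      by (simp only: D flag_sum_sum finite_lessThan)
    show ?thesis
    proof (cases us)
      \<comment> \<open>The recursion ends at the empty word, on which \<open>word_cochain\<close>
        is 1.\<close>
      case Nil
      then show ?thesis
        unfolding eq by (simp add: cyclic_diff_def w_def)
    next
      case (Cons u us')
      have "?D (w 0) = (\<lambda>x. \<Sum>i<p. w i x)"
        using False Cons by (auto simp: cyclic_diff_def w_def fun_eq_iff)
      then have "flag_sum p us (?D (w 0)) = (\<Sum>i<p. flag_sum p us (w i))"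
        by (simp only: flag_sum_sum finite_lessThan)
      moreover have "[(\<Sum>i<p. flag_sum p us (w i)) = 1] (mod int p)"
        unfolding w_def using \<open>distinct (v # us)\<close> \<open>set (v # us) \<subseteq> V\<close> Cons by (intro Cons.IH) auto
      ultimately show ?thesis
        using eq by simp
    qed
  qed
  then show ?case
    by (simp only: w_def)
qed simp

text \<open>A sum congruent to 1 modulo \<open>p\<close> has a nonzero term. Its support supplies a
  flag, and after rotation the labels of this flag have a nonzero word cochain.\<close>

theorem equivariant_label_alternating_flag:
  assumes "equivariant_label p V s" "p \<ge> 2" "finite V" "V \<noteq> {}"
  obtains x where "x \<in> flags p V" "distinct_adj (map s x)"
proof -
  obtain vs where vs: "set vs = V" "distinct vs"
    using finite_distinct_list[OF assms(3)] by blast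
  let ?w = "\<lambda>i x. word_cochain p (map s (map (rotate_map p ^^ i) x))"
  have "[(\<Sum>i<p. flag_sum p vs (?w i)) = 1] (mod int p)"
    using assms vs by (intro flag_sum_word_cochain[OF assms(1)]) auto
  then have "(\<Sum>i<p. flag_sum p vs (?w i)) \<noteq> 0"
    using assms(2) by (auto simp: cong_def)
  then obtain i where "flag_sum p vs (?w i) \<noteq> 0"
    by (meson sum.neutral)
  then obtain x where x: "x \<in> flags p V" "?w i x \<noteq> 0"
    using flag_sum_cong[of vs p "?w i" "\<lambda>x. 0"] vs assms(2) by (auto simp: flag_sum_zero)
  show thesis
    using that[of "map (rotate_map p ^^ i) x"] map_rotate_map_flags[OF x(1)]
      distinct_adj_if_word_cochain[OF x(2)] by blast
qed

text \<open>Along an alternating flag every step changes the label and so raises the rank, which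
  gives \<open>card V\<close> distinct ranks.\<close>

corollary equivariant_label_rank_bound:
  fixes rk :: "('a \<rightharpoonup> nat) \<Rightarrow> nat"
  assumes "equivariant_label p V s" "p \<ge> 2" "finite V"
    and rk: "\<And>X. X \<in> signed_sets p V \<Longrightarrow> rk X \<in> {1..m}"
    and mono: "\<And>X Y. X \<in> signed_sets p V \<Longrightarrow> Y \<in> signed_sets p V \<Longrightarrow> X \<subseteq>\<^sub>m Y \<Longrightarrow>
      s X \<noteq> s Y \<Longrightarrow> rk X < rk Y"
  shows "card V \<le> m"
proof (cases "V = {}")
  case False
  then obtain x where x: "x \<in> flags p V" "distinct_adj (map s x)"
    using equivariant_label_alternating_flag assms(1-3) by metis
  have "sorted_wrt (<) (map rk x)"
  proof -
    have "successively (\<lambda>X Y. rk X < rk Y) x"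
      unfolding successively_conv_nth
    proof (intro allI impI)
      fix i assume i: "Suc i < length x"
      then have "x ! i \<subseteq>\<^sub>m x ! Suc i" "x ! i \<in> signed_sets p V" "x ! Suc i \<in> signed_sets p V"
        using x(1) by (auto simp: flags_def sorted_wrt_iff_nth_less)
      moreover have "s (x ! i) \<noteq> s (x ! Suc i)"
        using x(2) i by (simp add: distinct_adj_def successively_map successively_conv_nth)
      ultimately show "rk (x ! i) < rk (x ! Suc i)"
        using mono by blast
    qed
    then show ?thesis
      by (simp add: successively_map flip: successively_conv_sorted_wrt)
  qed
  then have "distinct (map rk x)"
    by (simp add: strict_sorted_iff)
  then have "card V = card (set (map rk x))"
    using x(1) by (metis (mono_tags, lifting) distinct_card flags_def length_map mem_Collect_eq)
  also have "\<dots> \<le> card {1..m}"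
    using x(1) rk by (intro card_mono) (auto simp: flags_def)
  finally show ?thesis by simp
qed simp

subsection \<open>Equitable subcolorings and composite \<open>r\<close>\<close>

text \<open>Counts the vertices that are kept: for a hypergraph and \<open>r > 0\<close>, the
  largest possible \<open>m\<close> is \<open>card (verts H) - ecd r H\<close> by the next two
  lemmas.\<close>

definition equitable_subcoloring :: "'a hypergraph \<Rightarrow> nat \<Rightarrow> nat \<Rightarrow> bool" where
  "equitable_subcoloring H r m \<longleftrightarrow> (\<exists>A q. disjoint_family_on A {..<r} \<and>
     (\<forall>i<r. A i \<subseteq> verts H \<and> (\<forall>e\<in>edges H. \<not> e \<subseteq> A i) \<and> card (A i) \<in> {q, Suc q}) \<and>
     (\<Sum>i<r. card (A i)) = m)"

lemma ecd_le_if_equitable_subcoloring: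
  assumes H: "finite (verts H)" and m: "equitable_subcoloring H r m"
  shows "ecd r H + m \<le> card (verts H)"
proof -
  obtain A q where dj: "disjoint_family_on A {..<r}"
    and A: "\<And>i. i < r \<Longrightarrow> A i \<subseteq> verts H \<and> (\<forall>e\<in>edges H. \<not> e \<subseteq> A i) \<and> card (A i) \<in> {q, Suc q}"
    and sum: "(\<Sum>i<r. card (A i)) = m"
    using m by (auto simp: equitable_subcoloring_def)
  define N where "N = (\<Union>i<r. A i)"
  define c where "c = (\<lambda>v. THE i. i < r \<and> v \<in> A i)"
  have c: "c v = i" if "i < r" "v \<in> A i" for v i
    unfolding c_def using that dj by (auto simp: disjoint_family_on_def)
  have N: "N \<subseteq> verts H"
    using A by (auto simp: N_def)
  then have VN: "verts H - (verts H - N) = N"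
    by auto
  have cls: "color_class (induced_subhypergraph H N) c i = A i" if "i < r" for i
    using that c by (auto simp: color_class_def induced_subhypergraph_def N_def)
  have "card (A i) \<le> Suc (card (A j))" if "i < r" "j < r" for i j
    using A[OF that(1)] A[OF that(2)] by auto
  then have "\<bar>int (card (A i)) - int (card (A j))\<bar> \<le> 1" if "i < r" "j < r" for i j
    using that by (smt (verit) of_nat_Suc of_nat_le_iff)
  then have "equitable_coloring (induced_subhypergraph H N) r c"
    using A c cls unfolding equitable_coloring_def proper_coloring_def
    by (auto simp: induced_subhypergraph_def N_def)
  then have "ecd r H \<le> card (verts H - N)"
    unfolding ecd_def by (intro Least_le exI[of _ "verts H - N"]) (auto simp: VN)
  moreover have "card N = m"
  proof -
    have "finite (A i)" if "i < r" for i
      using A[OF that] H finite_subset by blast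
    then show ?thesis
      unfolding N_def sum[symmetric] using dj
      by (intro card_UN_disjoint) (auto simp: disjoint_family_on_def)
  qed
  ultimately show ?thesis
    using N H by (metis add.commute add_le_cancel_left card_Diff_subset card_mono finite_subset
        le_add_diff_inverse2)
qed

lemma equitable_subcoloring_ecd:
  assumes "hypergraph H" "r > 0"
  shows "equitable_subcoloring H r (card (verts H) - ecd r H)"
proof -
  obtain S c where S: "S \<subseteq> verts H" "card S = ecd r H"
    and c: "equitable_coloring (induced_subhypergraph H (verts H - S)) r c"
    using ecd_attained[OF assms(1)] by blast
  let ?H = "induced_subhypergraph H (verts H - S)"
  let ?A = "color_class ?H c"
  have A: "?A i = {v \<in> verts H - S. c v = i}" for i
    by (simp add: color_class_def induced_subhypergraph_def)
  have fin: "finite (verts H)"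
    using assms by (simp add: hypergraph_def)
  define q where "q = Min ((\<lambda>i. card (?A i)) ` {..<r})"
  have q: "q \<le> card (?A i)" if "i < r" for i
    using that by (simp add: q_def)
  have "q \<in> (\<lambda>i. card (?A i)) ` {..<r}"
    unfolding q_def using assms(2) by (intro Min_in) auto
  then obtain i0 where i0: "i0 < r" "card (?A i0) = q"
    by auto
  have card: "card (?A i) \<in> {q, Suc q}" if "i < r" for i
  proof -
    have "\<bar>int (card (?A i)) - int (card (?A i0))\<bar> \<le> 1"
      using c that i0(1) unfolding equitable_coloring_def by blast
    then show ?thesis
      using q[OF that] i0 by auto
  qed
  have less: "c v < r" if "v \<in> verts H - S" for v
    using c that by (simp add: equitable_coloring_def proper_coloring_def induced_subhypergraph_def)
  have "verts H - S = (\<Union>i<r. ?A i)"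
    using less by (auto simp: A)
  then have "card (verts H) - ecd r H = card (\<Union>i<r. ?A i)"
    using S fin by (metis card_Diff_subset finite_subset)
  also have "\<dots> = (\<Sum>i<r. card (?A i))"
    using fin by (intro card_UN_disjoint) (auto simp: A)
  finally have "(\<Sum>i<r. card (?A i)) = card (verts H) - ecd r H" ..
  moreover have "disjoint_family_on ?A {..<r}"
    by (auto simp: disjoint_family_on_def A)
  moreover have "\<not> e \<subseteq> ?A i" if "i < r" "e \<in> edges H" for i e
  proof
    assume e: "e \<subseteq> ?A i"
    then have "e \<subseteq> verts H - S"
      unfolding A by auto
    then have "e \<in> edges ?H"
      using that by (simp add: induced_subhypergraph_def)
    then show False
      using e that c by (auto simp: equitable_coloring_def proper_coloring_def)
  qed
  moreover have "?A i \<subseteq> verts H" for i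
    by (auto simp: A)
  ultimately show ?thesis
    unfolding equitable_subcoloring_def using card by blast
qed

text \<open>A vertex is deleted from a largest class; smaller classes still contain no edge.\<close>

lemma equitable_subcoloring_Suc:
  assumes "equitable_subcoloring H r (Suc m)" "finite (verts H)"
  shows "equitable_subcoloring H r m"
proof -
  obtain A q where dj: "disjoint_family_on A {..<r}"
    and A: "\<And>i. i < r \<Longrightarrow> A i \<subseteq> verts H \<and> (\<forall>e\<in>edges H. \<not> e \<subseteq> A i) \<and> card (A i) \<in> {q, Suc q}"
    and sum: "(\<Sum>i<r. card (A i)) = Suc m"
    using assms by (auto simp: equitable_subcoloring_def)
  have "\<exists>i q'. i < r \<and> card (A i) > 0 \<and> card (A i) - 1 \<in> {q', Suc q'} \<and>
     (\<forall>j<r. card (A j) \<in> {q', Suc q'})"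
  proof (cases "\<exists>i<r. card (A i) = Suc q")
    case True
    then obtain i where "i < r" "card (A i) = Suc q"
      by blast
    then show ?thesis
      using A by (intro exI[of _ i] exI[of _ q]) simp
  next
    \<comment> \<open>All classes have size \<open>q\<close>, so the smaller size becomes
      \<open>q - 1\<close>; here \<open>q > 0\<close> because the sizes sum to
      \<open>Suc m\<close>.\<close>
    case False
    then have all: "card (A i) = q" if "i < r" for i
      using A[OF that] that by auto
    then have "r * q = Suc m"
      using sum by simp
    then have "r > 0" "q > 0"
      by (cases r; cases q; simp)+
    then show ?thesis
      using all by (intro exI[of _ 0] exI[of _ "q - 1"]) auto
  qed
  then obtain i q' where i: "i < r" "card (A i) > 0" "card (A i) - 1 \<in> {q', Suc q'}"
    "\<And>j. j < r \<Longrightarrow> card (A j) \<in> {q', Suc q'}"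
    by blast
  then obtain v where v: "v \<in> A i"
    by fastforce
  define B where "B = A(i := A i - {v})"
  have "card (B i) = card (A i) - 1"
    using i v by (simp add: B_def)
  then have "card (B j) \<in> {q', Suc q'}" if "j < r" for j
    using i that by (cases "j = i") (auto simp: B_def)
  moreover have sub: "B j \<subseteq> A j" for j
    by (auto simp: B_def)
  moreover have "disjoint_family_on B {..<r}"
    using dj sub unfolding disjoint_family_on_def by blast
  moreover have "(\<Sum>j<r. card (B j)) = m"
  proof -
    have "(\<Sum>j<r. card (B j)) = card (A i) - 1 + (\<Sum>j\<in>{..<r} - {i}. card (A j))"
      using i(1) \<open>card (B i) = _\<close> by (subst sum.remove[of _ i]) (auto simp: B_def intro!: sum.cong)
    moreover have "(\<Sum>j<r. card (A j)) = card (A i) + (\<Sum>j\<in>{..<r} - {i}. card (A j))"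
      using i(1) by (subst sum.remove[of _ i]) auto
    ultimately show ?thesis
      using sum i(2) by simp
  qed
  ultimately show ?thesis
    unfolding equitable_subcoloring_def
    by (intro exI[of _ B] exI[of _ q']) (use A in \<open>meson subset_trans\<close>)
qed

lemma equitable_subcoloring_mono:
  assumes "hypergraph H" "r > 0" "m + ecd r H \<le> card (verts H)"
  shows "equitable_subcoloring H r m"
proof -
  have "m \<le> card (verts H) - ecd r H"
    using assms(3) by simp
  then show ?thesis
  proof (induction rule: inc_induct)
    case base
    show ?case using equitable_subcoloring_ecd assms by blast
  next
    case (step n)
    then show ?case
      using equitable_subcoloring_Suc assms(1) unfolding hypergraph_def by blast
  qed
qed

text \<open>Class sizes lie between the floor and the ceiling of their mean. These bounds do not
  mention \<open>q\<close>, so they can compare classes of different subcolorings.\<close>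

lemma equitable_size_bounds:
  fixes f :: "nat \<Rightarrow> nat"
  assumes f: "\<And>i. i < r \<Longrightarrow> f i \<in> {q, Suc q}" and i: "i < r"
  shows "sum f {..<r} div r \<le> f i" "f i \<le> (sum f {..<r} + r - 1) div r"
proof -
  have s: "sum f {..<r} = f i + sum f ({..<r} - {i})"
    using i by (subst sum.remove[of _ i]) auto
  have c: "card ({..<r} - {i}) = r - 1"
    using i by simp
  have "f j \<le> Suc (f i)" "f i \<le> Suc (f j)" if "j < r" for j
    using f[OF that] f[OF i] by auto
  then have b: "f j \<le> Suc (f i)" "f i \<le> Suc (f j)" if "j \<in> {..<r} - {i}" for j
    using that by auto
  have "sum f ({..<r} - {i}) \<le> (r - 1) * Suc (f i)"
    using sum_bounded_above[of "{..<r} - {i}" f "Suc (f i)", OF b(1)] c by simp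
  then have "sum f {..<r} < r * Suc (f i)"
    using s i by (cases r) auto
  then show "sum f {..<r} div r \<le> f i"
    using i by (simp add: div_less_iff_less_mult mult.commute less_Suc_eq_le[symmetric])
  have "sum (\<lambda>j. Suc (f j)) ({..<r} - {i}) \<ge> (r - 1) * f i"
    using sum_bounded_below[of "{..<r} - {i}" "f i" "\<lambda>j. Suc (f j)", OF b(2)] c by simp
  then have "(r - 1) * f i \<le> sum f ({..<r} - {i}) + (r - 1)"
    using c by (simp add: sum.distrib Suc_eq_plus1 del: One_nat_def)
  then have "r * f i \<le> sum f {..<r} + r - 1"
    using s i by (cases r) auto
  then show "f i \<le> (sum f {..<r} + r - 1) div r"
    using i by (simp add: less_eq_div_iff_mult_less_eq mult.commute)
qed

section \<open>Kneser colorings and products\<close>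

text \<open>Indices from 0 suit quotients and remainders. The colour \<open>j\<close> may be
  arbitrary, as \<open>r > 0\<close> provides an edge \<open>f 0\<close> that forces
  \<open>j < k\<close>.\<close>

lemma proper_coloring_kneser_iff:
  assumes "r > 0"
  shows "proper_coloring (kneser_hypergraph r H) k c \<longleftrightarrow>
    (\<forall>e\<in>edges H. c e < k) \<and>
    (\<forall>f j. disjoint_family_on f {..<r} \<longrightarrow> (\<forall>i<r. f i \<in> edges H) \<longrightarrow> (\<exists>i<r. c (f i) \<noteq> j))"
    (is "?L \<longleftrightarrow> ?R")
proof
  assume L: ?L
  have less: "c e < k" if "e \<in> edges H" for e
    using L that by (simp add: proper_coloring_def kneser_hypergraph_def)
  show ?R
  proof (intro conjI ballI allI impI less)
    fix f j assume f: "disjoint_family_on f {..<r}" "\<forall>i<r. f i \<in> edges H"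
    show "\<exists>i<r. c (f i) \<noteq> j"
    proof (rule ccontr)
      assume "\<not> ?thesis"
      then have j: "c (f i) = j" if "i < r" for i
        using that by blast
      define e where "e = (\<lambda>i. f (i - 1))"
      have pred: "i - 1 < r" if "i \<in> {1..r}" for i
        using that by auto
      then have "\<forall>i\<in>{1..r}. e i \<in> edges H"
        using f(2) by (simp add: e_def)
      moreover have "\<forall>i\<in>{1..r}. \<forall>j\<in>{1..r}. i \<noteq> j \<longrightarrow> e i \<inter> e j = {}"
      proof (intro ballI impI)
        fix i j assume ij: "i \<in> {1..r}" "j \<in> {1..r}" "i \<noteq> j"
        then have "i - 1 \<noteq> j - 1"
          by auto
        then show "e i \<inter> e j = {}"
          using f(1) pred ij unfolding e_def disjoint_family_on_def by blast
      qed
      ultimately have "e ` {1..r} \<in> edges (kneser_hypergraph r H)"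
        unfolding kneser_hypergraph_def snd_conv by blast
      moreover have "e ` {1..r} \<subseteq> color_class (kneser_hypergraph r H) c j"
        using f(2) j pred unfolding e_def color_class_def kneser_hypergraph_def fst_conv
        by blast
      moreover have "j < k"
        using less[of "f 0"] j[of 0] f(2) assms by simp
      ultimately show False
        using L by (simp add: proper_coloring_def)
    qed
  qed
next
  assume R: ?R
  have "\<not> e ` {1..r} \<subseteq> color_class (kneser_hypergraph r H) c j"
    if e: "\<forall>i\<in>{1..r}. e i \<in> edges H"
      and dj: "\<forall>i\<in>{1..r}. \<forall>j\<in>{1..r}. i \<noteq> j \<longrightarrow> e i \<inter> e j = {}" for e j
  proof
    assume j: "e ` {1..r} \<subseteq> color_class (kneser_hypergraph r H) c j"
    have "disjoint_family_on (\<lambda>i. e (Suc i)) {..<r}" "\<forall>i<r. e (Suc i) \<in> edges H"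
      using e dj by (auto simp: disjoint_family_on_def)
    then obtain i where "i < r" "c (e (Suc i)) \<noteq> j"
      using R by meson
    then show False
      using j by (auto simp: color_class_def image_subset_iff)
  qed
  then show ?L
    using R unfolding proper_coloring_def kneser_hypergraph_def fst_conv snd_conv by blast
qed

text \<open>Keeps the empty set out of the edges of the auxiliary hypergraph \<open>F\<close>
  below.\<close>

lemma ecd_induced_empty: "ecd r (induced_subhypergraph H {}) = 0" if "hypergraph H"
proof -
  have "hypergraph (induced_subhypergraph H {})"
    using that by (auto simp: hypergraph_def induced_subhypergraph_def)
  from ecd_attained[OF this, of r] show ?thesis
    by (auto simp: induced_subhypergraph_def)
qed

lemma kneser_bound_mult:
  fixes H :: "'a hypergraph"
  assumes A: "\<And>(H :: 'a hypergraph) k c. hypergraph H \<Longrightarrow>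
      proper_coloring (kneser_hypergraph a H) k c \<Longrightarrow> ecd a H \<le> (a - 1) * k"
    and B: "\<And>(H :: 'a hypergraph) k c. hypergraph H \<Longrightarrow>
      proper_coloring (kneser_hypergraph b H) k c \<Longrightarrow> ecd b H \<le> (b - 1) * k"
    and pos: "a > 0" "b > 0" and H: "hypergraph H"
    and c: "proper_coloring (kneser_hypergraph (a * b) H) k c"
  shows "ecd (a * b) H \<le> (a * b - 1) * k"
proof -
  define d where "d = (b - 1) * k"
  define F where "F = (verts H, {N. N \<subseteq> verts H \<and> d < ecd b (induced_subhypergraph H N)})"
  have F: "verts F = verts H" "edges F = {N. N \<subseteq> verts H \<and> d < ecd b (induced_subhypergraph H N)}"
    by (simp_all add: F_def)
  have hyp_ind: "hypergraph (induced_subhypergraph H N)" if "N \<subseteq> verts H" for N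
    using H that finite_subset by (auto simp: hypergraph_def induced_subhypergraph_def)
  have hypF: "hypergraph F"
    using H ecd_induced_empty[OF H] by (auto simp: hypergraph_def F_def)
  have c_less: "c e < k" if "e \<in> edges H" for e
    using c that pos by (simp add: proper_coloring_kneser_iff)
  have "\<exists>f j. disjoint_family_on f {..<b} \<and> (\<forall>i<b. f i \<in> edges H \<and> f i \<subseteq> N \<and> c (f i) = j)"
    if N: "N \<in> edges F" for N
  proof -
    have "\<not> proper_coloring (kneser_hypergraph b (induced_subhypergraph H N)) k c"
      using B[OF hyp_ind, of N k c] N by (auto simp: F d_def)
    then show ?thesis
      using c_less pos(2) by (auto simp: proper_coloring_kneser_iff induced_subhypergraph_def)
  qed
  then obtain f C where f: "\<And>N. N \<in> edges F \<Longrightarrow> disjoint_family_on (f N) {..<b}"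
    "\<And>N i. N \<in> edges F \<Longrightarrow> i < b \<Longrightarrow> f N i \<in> edges H \<and> f N i \<subseteq> N \<and> c (f N i) = C N"
    by metis
  \<comment> \<open>If \<open>a\<close> disjoint edges of \<open>F\<close> had the same colour,
    their chosen families would form \<open>a * b\<close> disjoint edges of \<open>H\<close> of that
    colour, indexed by quotient and remainder modulo \<open>b\<close>.\<close>
  have "proper_coloring (kneser_hypergraph a F) k C"
    unfolding proper_coloring_kneser_iff[OF pos(1)]
  proof (intro conjI ballI allI impI)
    fix N assume "N \<in> edges F"
    then show "C N < k"
      using f(2)[of N 0] c_less pos by force
  next
    fix g j assume g: "disjoint_family_on g {..<a}" "\<forall>i<a. g i \<in> edges F"
    show "\<exists>i<a. C (g i) \<noteq> j"
    proof (rule ccontr)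
      assume "\<not> ?thesis"
      then have j: "C (g i) = j" if "i < a" for i
        using that by blast
      define h where "h = (\<lambda>n. f (g (n div b)) (n mod b))"
      have h: "n div b < a" "n mod b < b" if "n < a * b" for n
        using that pos by (auto simp: less_mult_imp_div_less)
      have "disjoint_family_on h {..<a * b}"
        unfolding disjoint_family_on_def
      proof (intro ballI impI)
        fix m n assume mn: "m \<in> {..<a * b}" "n \<in> {..<a * b}" "m \<noteq> n"
        then have l: "m div b < a" "m mod b < b" "n div b < a" "n mod b < b"
          using h by auto
        show "h m \<inter> h n = {}"
        proof (cases "m div b = n div b")
          case True
          then have "m mod b \<noteq> n mod b"
            using mn(3) by (metis div_mult_mod_eq)
          then show ?thesis
            using True l f(1)[of "g (n div b)"] g(2) by (auto simp: h_def disjoint_family_on_def)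
        next
          case False
          then have "g (m div b) \<inter> g (n div b) = {}"
            using g(1) l by (auto simp: disjoint_family_on_def)
          moreover have "h m \<subseteq> g (m div b)" "h n \<subseteq> g (n div b)"
            using f(2) g(2) l by (simp_all add: h_def)
          ultimately show ?thesis by blast
        qed
      qed
      moreover have "h n \<in> edges H" "c (h n) = j" if "n < a * b" for n
        using h[OF that] f(2) g(2) j by (simp_all add: h_def)
      ultimately show False
        using c pos proper_coloring_kneser_iff[of "a * b" H k c] by (metis nat_0_less_mult_iff)
    qed
  qed
  then have ecdF: "ecd a F \<le> (a - 1) * k"
    using A hypF by blast
  \<comment> \<open>Since \<open>N i\<close> contains no edge of \<open>F\<close>, it is not one
    itself, so its defect for \<open>b\<close> is at most \<open>d\<close>.\<close>
  obtain N Q where N: "disjoint_family_on N {..<a}"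
    "\<And>i. i < a \<Longrightarrow> N i \<subseteq> verts H \<and> N i \<notin> edges F \<and> card (N i) \<in> {Q, Suc Q}"
    "(\<Sum>i<a. card (N i)) = card (verts H) - ecd a F"
    using equitable_subcoloring_ecd[OF hypF pos(1)] subset_refl
    unfolding equitable_subcoloring_def F(1) by metis
  \<comment> \<open>Exactly \<open>card (N i) - d\<close> vertices are kept even where the defect is
    below \<open>d\<close>, so that the \<open>M i\<close> still differ by at most one. Classes
    smaller than \<open>d\<close> keep none.\<close>
  define M where "M = (\<lambda>i. card (N i) - d)"
  have M: "equitable_subcoloring (induced_subhypergraph H (N i)) b (M i)" if "i < a" for i
  proof (rule equitable_subcoloring_mono)
    have "ecd b (induced_subhypergraph H (N i)) \<le> d"
      using N(2)[OF that] by (auto simp: F)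
    moreover have "ecd b (induced_subhypergraph H (N i)) \<le> card (N i)"
      using ecd_attained[OF hyp_ind] N(2)[OF that] H
      by (metis card_mono finite_subset fst_conv hypergraph_def induced_subhypergraph_def)
    ultimately show "M i + ecd b (induced_subhypergraph H (N i)) \<le> card (verts (induced_subhypergraph H (N i)))"
      by (simp add: M_def induced_subhypergraph_def)
  qed (use N(2)[OF that] hyp_ind pos(2) in auto)
  have "\<exists>P q. disjoint_family_on P {..<b} \<and>
     (\<forall>l<b. P l \<subseteq> N i \<and> (\<forall>e\<in>edges H. \<not> e \<subseteq> P l) \<and> card (P l) \<in> {q, Suc q}) \<and>
     (\<Sum>l<b. card (P l)) = M i" if "i < a" for i
  proof -
    obtain P q where P: "disjoint_family_on P {..<b}"
      "\<And>l. l < b \<Longrightarrow> P l \<subseteq> N i \<and>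
         (\<forall>e\<in>{e \<in> edges H. e \<subseteq> N i}. \<not> e \<subseteq> P l) \<and> card (P l) \<in> {q, Suc q}"
      "(\<Sum>l<b. card (P l)) = M i"
      using M[OF \<open>i < a\<close>]
      unfolding equitable_subcoloring_def induced_subhypergraph_def fst_conv snd_conv by blast
    have "\<not> e \<subseteq> P l" if "l < b" "e \<in> edges H" for e l
      using P(2)[OF that(1)] that(2) by blast
    then show ?thesis
      using P by (intro exI[of _ P] exI[of _ q]) simp
  qed
  then obtain P q where P: "\<And>i. i < a \<Longrightarrow> disjoint_family_on (P i) {..<b}"
    "\<And>i l. i < a \<Longrightarrow> l < b \<Longrightarrow> P i l \<subseteq> N i \<and> (\<forall>e\<in>edges H. \<not> e \<subseteq> P i l) \<and> card (P i l) \<in> {q i, Suc (q i)}"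
    "\<And>i. i < a \<Longrightarrow> (\<Sum>l<b. card (P i l)) = M i"
    by metis
  define R where "R = (\<lambda>n. P (n div b) (n mod b))"
  have h: "n div b < a" "n mod b < b" if "n < a * b" for n
    using that pos by (auto simp: less_mult_imp_div_less)
  have "disjoint_family_on R {..<a * b}"
    unfolding disjoint_family_on_def
  proof (intro ballI impI)
    fix m n assume mn: "m \<in> {..<a * b}" "n \<in> {..<a * b}" "m \<noteq> n"
    then have l: "m div b < a" "m mod b < b" "n div b < a" "n mod b < b"
      using h by auto
    show "R m \<inter> R n = {}"
    proof (cases "m div b = n div b")
      case True
      then have "m mod b \<noteq> n mod b"
        using mn(3) by (metis div_mult_mod_eq)
      then show ?thesis
        using True l P(1)[of "n div b"] by (auto simp: R_def disjoint_family_on_def)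
    next
      case False
      then have "N (m div b) \<inter> N (n div b) = {}"
        using N(1) l by (auto simp: disjoint_family_on_def)
      moreover have "R m \<subseteq> N (m div b)" "R n \<subseteq> N (n div b)"
        using P(2) l by (simp_all add: R_def)
      ultimately show ?thesis by blast
    qed
  qed
  moreover have "R n \<subseteq> verts H \<and> (\<forall>e\<in>edges H. \<not> e \<subseteq> R n) \<and>
      card (R n) \<in> {(Q - d) div b, Suc ((Q - d) div b)}" if "n < a * b" for n
  proof -
    note l = h[OF that]
    have MQ: "Q - d \<le> M (n div b)" "M (n div b) \<le> Suc (Q - d)"
      using N(2)[OF l(1)] by (auto simp: M_def)
    \<comment> \<open>As \<open>M\<close> is \<open>Q - d\<close> or one more, the ceiling of
      \<open>M / b\<close> exceeds the floor of \<open>(Q - d) / b\<close> by at most one, uniformly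
      in \<open>n\<close>.\<close>
    have "M (n div b) div b \<le> card (R n)" "card (R n) \<le> (M (n div b) + b - 1) div b"
      using equitable_size_bounds[of b "\<lambda>l. card (P (n div b) l)" "q (n div b)" "n mod b"]
        P(2)[OF l(1)] P(3)[OF l(1)] l(2) by (auto simp: R_def)
    moreover have "(Q - d) div b \<le> M (n div b) div b"
      using MQ(1) by (rule div_le_mono)
    moreover have "(M (n div b) + b - 1) div b \<le> ((Q - d) + b) div b"
      using MQ(2) by (intro div_le_mono) auto
    ultimately have "(Q - d) div b \<le> card (R n)" "card (R n) \<le> Suc ((Q - d) div b)"
      using pos(2) by auto
    then show ?thesis
      using P(2)[OF l] N(2)[OF l(1)] by (auto simp: R_def)
  qed
  moreover have sum: "(\<Sum>n<a * b. card (R n)) = (\<Sum>i<a. M i)"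
  proof -
    have "(\<Sum>n\<in>{i * b..<i * b + b}. card (R n)) = M i" if "i < a" for i
    proof -
      have "(\<Sum>n\<in>{i * b..<i * b + b}. card (R n)) = (\<Sum>l<b. card (R (i * b + l)))"
        by (rule sum.reindex_bij_witness[of _ "\<lambda>l. i * b + l" "\<lambda>n. n - i * b"]) auto
      also have "\<dots> = (\<Sum>l<b. card (P i l))"
        using pos by (intro sum.cong) (auto simp: R_def)
      finally show ?thesis
        using P(3)[OF that] by simp
    qed
    then show ?thesis
      by (simp flip: sum.nat_group)
  qed
  ultimately have "equitable_subcoloring H (a * b) (\<Sum>i<a. M i)"
    unfolding equitable_subcoloring_def by blast
  then have "ecd (a * b) H + (\<Sum>i<a. M i) \<le> card (verts H)"
    using H by (intro ecd_le_if_equitable_subcoloring) (auto simp: hypergraph_def)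
  \<comment> \<open>The losses are \<open>ecd a F\<close> from the outer subcoloring and at most
    \<open>d\<close> from each of its \<open>a\<close> classes.\<close>
  moreover have "card (verts H) - ecd a F \<le> (\<Sum>i<a. M i) + a * d"
  proof -
    have "(\<Sum>i<a. card (N i)) \<le> (\<Sum>i<a. M i + d)"
      by (intro sum_mono) (simp add: M_def)
    then show ?thesis
      by (simp add: N(3) sum.distrib)
  qed
  moreover have "(a - 1) * k + a * d = (a * b - 1) * k"
    using pos unfolding d_def by (cases a; cases b) (auto simp: algebra_simps)
  ultimately show ?thesis
    using ecdF by linarith
qed

subsection \<open>Prime \<open>r\<close>\<close>

text \<open>The mean of \<open>S\<close> modulo \<open>p\<close>: the \<open>SOME\<close> term is an
  inverse of \<open>card S\<close> when one exists.\<close>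

definition sign_choice :: "nat \<Rightarrow> nat set \<Rightarrow> nat" where
  "sign_choice p S = \<Sum>S * (SOME m. [card S * m = 1] (mod p)) mod p"

lemma inj_on_shift: "inj_on (shift p) {..<p}"
  by (auto simp: inj_on_def shift_def mod_Suc split: if_splits)

lemma card_image_shift: "S \<subseteq> {..<p} \<Longrightarrow> card (shift p ` S) = card S"
  using inj_on_shift by (intro card_image) (rule inj_on_subset)

text \<open>Shifting adds \<open>card S\<close> to the sum modulo \<open>p\<close>, hence 1 to the
  mean. Primality makes \<open>card S\<close> invertible, as it lies strictly between 0 and
  \<open>p\<close>.\<close>

lemma sign_choice_shift:
  assumes "prime p" "S \<subseteq> {..<p}" "S \<noteq> {}" "S \<noteq> {..<p}"
  shows "sign_choice p (shift p ` S) = shift p (sign_choice p S)"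
proof -
  have fin: "finite S"
    using assms(2) finite_subset by blast
  have "card S < p"
    using psubset_card_mono[of "{..<p}" S] assms by auto
  moreover have "card S > 0"
    using fin assms(3) by (simp add: card_gt_0_iff)
  ultimately have "coprime (card S) p"
    using assms(1) by (metis coprime_commute nat_dvd_not_less prime_imp_coprime_nat)
  define m where "m = (SOME m. [card S * m = 1] (mod p))"
  have m: "[card S * m = 1] (mod p)"
    unfolding m_def
    using cong_solve_coprime_nat[OF \<open>coprime (card S) p\<close>, folded One_nat_def] by (rule someI_ex)
  have "\<Sum>(shift p ` S) = (\<Sum>a\<in>S. Suc a mod p)"
    using inj_on_subset[OF inj_on_shift assms(2)] by (simp add: sum.reindex) (simp add: shift_def)
  then have "[\<Sum>(shift p ` S) = (\<Sum>a\<in>S. Suc a)] (mod p)"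
    by (simp add: cong_def mod_sum_eq)
  also have "(\<Sum>a\<in>S. Suc a) = \<Sum>S + card S"
    using sum.distrib[of "\<lambda>a. a" "\<lambda>_. 1" S] by simp
  finally have "[\<Sum>(shift p ` S) * m = (\<Sum>S + card S) * m] (mod p)"
    by (rule cong_mult) simp
  also have "(\<Sum>S + card S) * m = \<Sum>S * m + card S * m"
    by (simp add: algebra_simps)
  also have "[\<Sum>S * m + card S * m = \<Sum>S * m + 1] (mod p)"
    using m by (intro cong_add) auto
  finally have "\<Sum>(shift p ` S) * m mod p = shift p (\<Sum>S * m mod p)"
    by (simp add: shift_def[of p "_ mod p"] mod_Suc_eq cong_def)
  then show ?thesis
    by (simp add: sign_choice_def card_image_shift[OF assms(2)] m_def)
qed

section \<open>Sizes of sign classes\<close>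

definition sign_class :: "('a \<rightharpoonup> nat) \<Rightarrow> nat \<Rightarrow> 'a set" where
  "sign_class X a = {v. X v = Some a}"

definition min_class :: "nat \<Rightarrow> ('a \<rightharpoonup> nat) \<Rightarrow> nat" where
  "min_class p X = Min ((\<lambda>a. card (sign_class X a)) ` {..<p})"

definition large_signs :: "nat \<Rightarrow> ('a \<rightharpoonup> nat) \<Rightarrow> nat set" where
  "large_signs p X = {a. a < p \<and> min_class p X < card (sign_class X a)}"

text \<open>The largest size of a subset of the domain whose sign classes are equitable.\<close>

definition balanced_size :: "nat \<Rightarrow> ('a \<rightharpoonup> nat) \<Rightarrow> nat" where
  "balanced_size p X = p * min_class p X + card (large_signs p X)"

lemma disjoint_family_on_sign_class:
  assumes "\<And>a. a \<in> I \<Longrightarrow> A a \<subseteq> sign_class X a"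
  shows "disjoint_family_on A I"
  unfolding disjoint_family_on_def
proof (intro ballI impI)
  fix a b assume ab: "a \<in> I" "b \<in> I" "a \<noteq> b"
  then have "sign_class X a \<inter> sign_class X b = {}"
    by (auto simp: sign_class_def)
  then show "A a \<inter> A b = {}"
    using assms[OF ab(1)] assms[OF ab(2)] by blast
qed

lemma sign_class_rotate_map:
  assumes "ran X \<subseteq> {..<p}" "a < p"
  shows "sign_class (rotate_map p X) (shift p a) = sign_class X a"
proof -
  have "shift p b = shift p a \<longleftrightarrow> b = a" if "X v = Some b" for v b
    using that assms inj_on_shift[of p] by (intro inj_on_eq_iff) (auto simp: ran_def)
  then show ?thesis
    by (force simp: sign_class_def rotate_map_def)
qed

lemma image_shift_lessThan: "shift p ` {..<p} = {..<p}"
  using shift_less inj_on_shift by (intro endo_inj_surj) auto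

lemma min_class_rotate_map:
  assumes "ran X \<subseteq> {..<p}" shows "min_class p (rotate_map p X) = min_class p X"
proof -
  have "(\<lambda>a. card (sign_class (rotate_map p X) a)) ` {..<p}
      = (\<lambda>a. card (sign_class (rotate_map p X) a)) ` shift p ` {..<p}"
    by (simp only: image_shift_lessThan)
  also have "\<dots> = (\<lambda>a. card (sign_class X a)) ` {..<p}"
    using assms by (simp add: image_image sign_class_rotate_map cong: image_cong_simp)
  finally show ?thesis
    by (simp add: min_class_def)
qed

lemma image_shift_Collect:
  assumes "\<And>a. a < p \<Longrightarrow> P (shift p a) \<longleftrightarrow> Q a"
  shows "{a. a < p \<and> P a} = shift p ` {a. a < p \<and> Q a}"
proof -
  have "{a. a < p \<and> P a} = {a \<in> shift p ` {..<p}. P a}"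
    by (auto simp: image_shift_lessThan)
  also have "\<dots> = shift p ` {a. a < p \<and> Q a}"
    using assms by auto
  finally show ?thesis .
qed

lemma large_signs_rotate_map:
  assumes "ran X \<subseteq> {..<p}" shows "large_signs p (rotate_map p X) = shift p ` large_signs p X"
  unfolding large_signs_def using assms
  by (intro image_shift_Collect) (simp add: sign_class_rotate_map min_class_rotate_map)

lemma balanced_size_rotate_map:
  assumes "ran X \<subseteq> {..<p}" shows "balanced_size p (rotate_map p X) = balanced_size p X"
  using assms by (simp add: balanced_size_def min_class_rotate_map large_signs_rotate_map)
    (auto simp: large_signs_def intro!: card_image_shift)

lemma min_class_le: "a < p \<Longrightarrow> min_class p X \<le> card (sign_class X a)"
  by (simp add: min_class_def)

lemma min_class_attained:
  assumes "p > 0" obtains a where "a < p" "card (sign_class X a) = min_class p X"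
proof -
  have "min_class p X \<in> (\<lambda>a. card (sign_class X a)) ` {..<p}"
    unfolding min_class_def using assms by (intro Min_in) auto
  then show thesis using that by auto
qed

lemma large_signs_proper:
  assumes "p > 0" shows "large_signs p X \<noteq> {..<p}"
proof -
  obtain a where "a < p" "card (sign_class X a) = min_class p X"
    using min_class_attained[OF assms] .
  then have "a \<in> {..<p} - large_signs p X"
    by (simp add: large_signs_def)
  then show ?thesis
    by blast
qed

lemma large_signs_subset: "large_signs p X \<subseteq> {..<p}"
  by (auto simp: large_signs_def)

lemma card_large_signs: "p > 0 \<Longrightarrow> card (large_signs p X) < p"
  using psubset_card_mono[of "{..<p}" "large_signs p X"] large_signs_proper[of p X]
    large_signs_subset[of p X]
  by (simp add: psubset_eq)

lemma finite_sign_class: "finite (dom X) \<Longrightarrow> finite (sign_class X a)"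
  by (erule finite_subset[rotated]) (auto simp: sign_class_def)

lemma sign_class_mono: "X \<subseteq>\<^sub>m Y \<Longrightarrow> sign_class X a \<subseteq> sign_class Y a"
  by (force simp: sign_class_def map_le_def dom_def)

text \<open>Because \<open>card (large_signs p X) < p\<close>, the balanced size orders the pairs of
  minimum and number of large signs lexicographically. The minimum grows with the map, and for a
  fixed minimum so does the set of large signs.\<close>

lemma balanced_size_mono:
  assumes "X \<subseteq>\<^sub>m Y" "finite (dom Y)" "p > 0"
  shows "balanced_size p X \<le> balanced_size p Y"
    and "balanced_size p X = balanced_size p Y \<Longrightarrow>
      min_class p X = min_class p Y \<and> large_signs p X = large_signs p Y"
proof -
  have card: "card (sign_class X a) \<le> card (sign_class Y a)" for a
    using assms by (intro card_mono sign_class_mono finite_sign_class)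
  obtain a where "a < p" "card (sign_class Y a) = min_class p Y"
    using min_class_attained[OF assms(3)] .
  then have le: "min_class p X \<le> min_class p Y"
    using min_class_le[of a p X] card[of a] by simp
  have sub: "large_signs p X \<subseteq> large_signs p Y" if "min_class p X = min_class p Y"
    using card that by (auto simp: large_signs_def intro: less_le_trans)
  have fin: "finite (large_signs p Y)"
    by (simp add: large_signs_def)
  have strict: "balanced_size p X < balanced_size p Y" if "min_class p X < min_class p Y"
  proof -
    have "balanced_size p X < p * Suc (min_class p X)"
      using card_large_signs[OF assms(3), of X] by (simp add: balanced_size_def)
    also have "\<dots> \<le> p * min_class p Y"
      using that by (intro mult_le_mono2) simp
    finally show ?thesis by (simp add: balanced_size_def)
  qed
  show "balanced_size p X \<le> balanced_size p Y"
  proof (cases "min_class p X = min_class p Y")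
    case True
    then show ?thesis
      using card_mono[OF fin sub] by (simp add: balanced_size_def)
  qed (use strict le in auto)
  show "min_class p X = min_class p Y \<and> large_signs p X = large_signs p Y"
    if eq: "balanced_size p X = balanced_size p Y"
  proof -
    have m: "min_class p X = min_class p Y"
      using strict le eq by force
    then show ?thesis
      using card_subset_eq[OF fin sub] eq by (simp add: balanced_size_def)
  qed
qed

text \<open>Without large signs all classes of \<open>X\<close> and \<open>Y\<close> have the same
  size, so nested classes coincide.\<close>

lemma eq_if_balanced_size_eq:
  assumes "X \<subseteq>\<^sub>m Y" "finite (dom Y)" "p > 0" "ran Y \<subseteq> {..<p}"
    and "balanced_size p X = balanced_size p Y" "large_signs p X = {}"
  shows "X = Y"
proof -
  have e: "min_class p X = min_class p Y" "large_signs p Y = {}"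
    using balanced_size_mono(2)[OF assms(1-3,5)] assms(6) by auto
  have "Y v = Some a \<Longrightarrow> X v = Some a" for v a
  proof -
    assume Y: "Y v = Some a"
    then have a: "a < p"
      using assms(4) by (auto simp: ran_def)
    then have "card (sign_class X a) = card (sign_class Y a)"
      using e assms(6) min_class_le[OF a, of X] min_class_le[OF a, of Y] by (force simp: large_signs_def)
    then have "sign_class X a = sign_class Y a"
      using assms by (intro card_subset_eq finite_sign_class sign_class_mono)
    then show "X v = Some a"
      using Y by (auto simp: sign_class_def)
  qed
  then have "Y \<subseteq>\<^sub>m X"
    by (force simp: map_le_def)
  then show ?thesis
    using assms(1) by (rule map_le_antisym[rotated])
qed

text \<open>If the minimum is 0, any nonempty class is large. This lets ranks start at 1.\<close>

lemma balanced_size_pos: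
  assumes "X \<in> signed_sets p V" "finite V"
  shows "balanced_size p X > 0"
proof (rule ccontr)
  assume "\<not> balanced_size p X > 0"
  then have z: "p * min_class p X = 0" "card (large_signs p X) = 0"
    by (auto simp: balanced_size_def)
  obtain v a where v: "X v = Some a" "a < p"
    using assms by (auto simp: signed_sets_def ran_def fun_eq_iff)
  have "finite (dom X)"
    using assms finite_subset by (auto simp: signed_sets_def)
  then have "card (sign_class X a) > 0"
    using v finite_sign_class[of X a] by (auto simp: card_gt_0_iff) (auto simp: sign_class_def)
  then have "a \<in> large_signs p X"
    using v z by (auto simp: large_signs_def)
  then show False
    using z(2) by (auto simp: large_signs_def)
qed

text \<open>Otherwise, trimming large classes to one above the minimum and the others to the minimum
  would give an equitable subcoloring with too many vertices.\<close>

lemma edge_in_sign_class_if_balanced_size: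
  assumes H: "hypergraph H" and X: "X \<in> signed_sets p (verts H)"
    and large: "card (verts H) - ecd p H < balanced_size p X"
  obtains a e where "a < p" "e \<in> edges H" "e \<subseteq> sign_class X a"
proof (rule ccontr)
  note found = that
  assume "\<not> thesis"
  then have no: "\<not> e \<subseteq> sign_class X a" if "a < p" "e \<in> edges H" for a e
    using that found by blast
  let ?h = "min_class p X"
  have fin: "finite (verts H)"
    using H by (simp add: hypergraph_def)
  have "\<exists>A. A \<subseteq> sign_class X a \<and> card A = ?h + of_bool (a \<in> large_signs p X)" if "a < p" for a
  proof -
    have "?h + of_bool (a \<in> large_signs p X) \<le> card (sign_class X a)"
      using min_class_le[OF that, of X] by (auto simp: large_signs_def)
    then show ?thesis
      by (metis obtain_subset_with_card_n)
  qed
  then obtain A where A: "\<And>a. a < p \<Longrightarrow> A a \<subseteq> sign_class X a"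
    "\<And>a. a < p \<Longrightarrow> card (A a) = ?h + of_bool (a \<in> large_signs p X)"
    by metis
  have "(\<Sum>a<p. card (A a)) = (\<Sum>a<p. ?h + of_bool (a \<in> large_signs p X))"
    using A by (intro sum.cong) auto
  also have "\<dots> = balanced_size p X"
    by (simp add: sum.distrib balanced_size_def Int_absorb1 large_signs_subset Int_commute flip: sum.inter_filter)
  finally have "(\<Sum>a<p. card (A a)) = balanced_size p X" .
  moreover have "disjoint_family_on A {..<p}"
    using A(1) by (auto intro: disjoint_family_on_sign_class)
  moreover have "A a \<subseteq> verts H \<and> (\<forall>e\<in>edges H. \<not> e \<subseteq> A a) \<and> card (A a) \<in> {?h, Suc ?h}" if "a < p" for a
  proof -
    have "sign_class X a \<subseteq> verts H"
      using X by (auto simp: signed_sets_def sign_class_def)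
    then show ?thesis
      using A[OF that] no[OF that] by (auto dest: subset_trans)
  qed
  ultimately have "equitable_subcoloring H p (balanced_size p X)"
    unfolding equitable_subcoloring_def by blast
  from ecd_le_if_equitable_subcoloring[OF fin this] show False
    using large by simp
qed

section \<open>Edges and colours inside sign classes\<close>

definition color_pairs :: "'a set set \<Rightarrow> ('a set \<Rightarrow> nat) \<Rightarrow> nat \<Rightarrow> ('a \<rightharpoonup> nat) \<Rightarrow> (nat \<times> nat) set" where
  "color_pairs E c p X = {(a, j). a < p \<and> (\<exists>e\<in>E. e \<subseteq> sign_class X a \<and> c e = j)}"

text \<open>The signs occurring with one selected colour. The selection depends only on the set of
  colours, which rotation preserves, and a single colour never occurs with all signs.\<close>

definition chosen_level :: "(nat \<times> nat) set \<Rightarrow> nat set" where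
  "chosen_level T = {a. (a, SOME j. j \<in> snd ` T) \<in> T}"

lemma chosen_level_color_pairs_rotate_map:
  assumes "ran X \<subseteq> {..<p}"
  shows "chosen_level (color_pairs E c p (rotate_map p X)) = shift p ` chosen_level (color_pairs E c p X)"
proof -
  let ?T = "color_pairs E c p X" and ?T' = "color_pairs E c p (rotate_map p X)"
  have level: "{a. (a, j) \<in> ?T'} = shift p ` {a. (a, j) \<in> ?T}" for j
    using image_shift_Collect[of p "\<lambda>a. \<exists>e\<in>E. e \<subseteq> sign_class (rotate_map p X) a \<and> c e = j"
        "\<lambda>a. \<exists>e\<in>E. e \<subseteq> sign_class X a \<and> c e = j"] assms
    by (simp add: color_pairs_def sign_class_rotate_map)
  have "snd ` ?T' = {j. {a. (a, j) \<in> ?T'} \<noteq> {}}" "snd ` ?T = {j. {a. (a, j) \<in> ?T} \<noteq> {}}"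
    by force+
  then have "snd ` ?T' = snd ` ?T"
    by (simp add: level)
  then show ?thesis
    by (simp add: chosen_level_def level)
qed

lemma chosen_level_nonempty:
  assumes "T \<noteq> {}" shows "chosen_level T \<noteq> {}"
proof -
  have "(SOME j. j \<in> snd ` T) \<in> snd ` T"
    using assms by (simp add: some_in_eq)
  then obtain a where "(a, SOME j. j \<in> snd ` T) \<in> T"
    by (metis (lifting) imageE prod.collapse)
  then show ?thesis
    unfolding chosen_level_def by blast
qed

lemma color_pairs_mono: "X \<subseteq>\<^sub>m Y \<Longrightarrow> color_pairs E c p X \<subseteq> color_pairs E c p Y"
  unfolding color_pairs_def by (blast dest: sign_class_mono)

lemma kneser_bound_prime:
  assumes p: "prime p" and H: "hypergraph H"
    and c: "proper_coloring (kneser_hypergraph p H) k c"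
  shows "ecd p H \<le> (p - 1) * k"
proof -
  define V where "V = verts H"
  define \<alpha> where "\<alpha> = card V - ecd p H"
  let ?T = "color_pairs (edges H) c p"
  \<comment> \<open>With no large sign, the label is the sign of a vertex selected from
    \<open>dom X\<close> alone, a selection that rotation does not affect.\<close>
  define s where "s = (\<lambda>X. if balanced_size p X \<le> \<alpha>
     then if large_signs p X = {} then the (X (SOME v. v \<in> dom X)) else sign_choice p (large_signs p X)
     else sign_choice p (chosen_level (?T X)))"
  define rk where "rk = (\<lambda>X. if balanced_size p X \<le> \<alpha> then balanced_size p X else \<alpha> + card (?T X))"
  have p2: "p \<ge> 2" "p > 0"
    using p prime_ge_2_nat by (auto simp: prime_gt_0_nat)
  have V: "finite V"
    using H by (simp add: hypergraph_def V_def)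
  have fin: "finite (dom X)" if "X \<in> signed_sets p V" for X
    using that V finite_subset by (auto simp: signed_sets_def)
  have ran: "ran X \<subseteq> {..<p}" if "X \<in> signed_sets p V" for X
    using that by (auto simp: signed_sets_def)
  have c_less: "c e < k" if "e \<in> edges H" for e
    using c that p2 by (simp add: proper_coloring_kneser_iff)
  \<comment> \<open>Edges of colour \<open>j\<close> in all \<open>p\<close> sign classes would be
    disjoint, against the proper coloring.\<close>
  have level: "{a. (a, j) \<in> ?T X} \<noteq> {..<p}" for j X
  proof
    assume "{a. (a, j) \<in> ?T X} = {..<p}"
    then have "\<forall>a<p. \<exists>e\<in>edges H. e \<subseteq> sign_class X a \<and> c e = j"
      by (auto simp: color_pairs_def)
    then obtain f where f: "\<And>a. a < p \<Longrightarrow> f a \<in> edges H \<and> f a \<subseteq> sign_class X a \<and> c (f a) = j"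
      by metis
    then have "disjoint_family_on f {..<p}"
      by (intro disjoint_family_on_sign_class[of _ f X]) blast
    then obtain i where "i < p" "c (f i) \<noteq> j"
      using c f p2 unfolding proper_coloring_kneser_iff[OF p2(2)] by metis
    then show False
      using f by blast
  qed
  have level_sub: "{a. (a, j) \<in> ?T X} \<subseteq> {..<p}" for j X
    by (auto simp: color_pairs_def)
  have T_nonempty: "?T X \<noteq> {}" if "X \<in> signed_sets p V" "\<not> balanced_size p X \<le> \<alpha>" for X
  proof -
    have "X \<in> signed_sets p (verts H)" "card (verts H) - ecd p H < balanced_size p X"
      using that by (auto simp: V_def \<alpha>_def)
    then obtain a e where "a < p" "e \<in> edges H" "e \<subseteq> sign_class X a"
      by (rule edge_in_sign_class_if_balanced_size[OF H])
    then show ?thesis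
      by (auto simp: color_pairs_def)
  qed
  have T_sub: "?T X \<subseteq> {..<p} \<times> {..<k}" for X
    using c_less by (auto simp: color_pairs_def)
  have T_fin: "finite (?T X)" for X
    using T_sub by (rule finite_subset) simp
  have T_pos: "card (?T X) > 0" if "X \<in> signed_sets p V" "\<not> balanced_size p X \<le> \<alpha>" for X
    using T_nonempty[OF that] T_fin by (simp add: card_gt_0_iff)
  \<comment> \<open>Each of the \<open>k\<close> colours misses at least one sign.\<close>
  have T_card: "card (?T X) \<le> (p - 1) * k" for X
  proof -
    have "?T X = (\<Union>j<k. {a. (a, j) \<in> ?T X} \<times> {j})"
      using T_sub by fastforce
    then have "card (?T X) = card (\<Union>j<k. {a. (a, j) \<in> ?T X} \<times> {j})"
      by simp
    also have "\<dots> \<le> (\<Sum>j<k. card ({a. (a, j) \<in> ?T X} \<times> {j}))"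
      by (intro card_UN_le) simp
    also have "\<dots> \<le> (\<Sum>j<k. p - 1)"
    proof (intro sum_mono)
      fix j
      have "card {a. (a, j) \<in> ?T X} < card {..<p}"
        using level level_sub by (intro psubset_card_mono psubsetI) auto
      then show "card ({a. (a, j) \<in> ?T X} \<times> {j}) \<le> p - 1"
        by (simp add: card_cartesian_product)
    qed
    finally show ?thesis
      by (simp add: mult.commute)
  qed
  have "equivariant_label p V s"
    unfolding equivariant_label_def
  proof (intro ballI conjI)
    fix X assume X: "X \<in> signed_sets p V"
    have dom: "dom (rotate_map p X) = dom X"
      by (auto simp: rotate_map_def dom_def)
    have "X \<noteq> Map.empty"
      using X by (simp add: signed_sets_def)
    then have "(SOME v. v \<in> dom X) \<in> dom X"
      by (simp only: some_in_eq dom_eq_empty_conv not_False_eq_True)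
    then obtain a where a: "X (SOME v. v \<in> dom X) = Some a"
      by (meson domD)
    then have "a < p"
      using ran[OF X] ranI[of X, OF a] by blast
    then show "s X < p"
      using a p2 by (simp add: s_def sign_choice_def)
    have "sign_choice p (shift p ` chosen_level (?T X)) = shift p (sign_choice p (chosen_level (?T X)))"
      if "\<not> balanced_size p X \<le> \<alpha>"
      using chosen_level_nonempty[OF T_nonempty[OF X that]] level level_sub
      by (intro sign_choice_shift p) (auto simp: chosen_level_def)
    moreover have "sign_choice p (shift p ` large_signs p X) = shift p (sign_choice p (large_signs p X))"
      if "large_signs p X \<noteq> {}"
      using p large_signs_subset that large_signs_proper[OF p2(2)] by (rule sign_choice_shift)
    moreover have "the (rotate_map p X (SOME v. v \<in> dom (rotate_map p X))) = shift p a"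
      unfolding dom using a by (simp add: rotate_map_def)
    ultimately show "s (rotate_map p X) = shift p (s X)"
      using a by (simp add: s_def ran[OF X] balanced_size_rotate_map large_signs_rotate_map
          chosen_level_color_pairs_rotate_map)
  qed
  moreover have "rk X \<in> {1..\<alpha> + (p - 1) * k}" if "X \<in> signed_sets p V" for X
  proof (cases "balanced_size p X \<le> \<alpha>")
    case True
    then show ?thesis
      using balanced_size_pos[OF that V] by (simp add: rk_def)
  next
    case False
    then show ?thesis
      using T_pos[OF that] T_card[of X] by (simp add: rk_def)
  qed
  moreover have "rk X < rk Y"
    if X: "X \<in> signed_sets p V" and Y: "Y \<in> signed_sets p V" and le: "X \<subseteq>\<^sub>m Y" and ne: "s X \<noteq> s Y" for X Y
  proof (cases "balanced_size p Y \<le> \<alpha>")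
    case True
    have XY: "balanced_size p X \<le> balanced_size p Y"
      using le fin[OF Y] p2 by (intro balanced_size_mono)
    \<comment> \<open>Equal balanced sizes give equal large signs, or equal maps if none is large,
      and hence equal labels.\<close>
    have "balanced_size p X \<noteq> balanced_size p Y"
    proof
      assume eq: "balanced_size p X = balanced_size p Y"
      then have "large_signs p X = large_signs p Y"
        using balanced_size_mono(2)[OF le fin[OF Y]] p2 by blast
      moreover have "X = Y" if "large_signs p X = {}"
        using le fin[OF Y] p2(2) ran[OF Y] eq that by (rule eq_if_balanced_size_eq)
      ultimately have "s X = s Y"
        using True eq by (auto simp: s_def)
      then show False
        using ne by simp
    qed
    then show ?thesis
      using True XY by (simp add: rk_def)
  next
    case False
    show ?thesis
    proof (cases "balanced_size p X \<le> \<alpha>")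
      case True
      then show ?thesis
        using False T_pos[OF Y False] by (simp add: rk_def)
    next
      \<comment> \<open>Above the threshold the label is a function of the set of pairs, so this set
        must have grown.\<close>
      case False': False
      then have "?T X \<noteq> ?T Y"
        using ne False by (auto simp: s_def)
      then have "card (?T X) < card (?T Y)"
        using color_pairs_mono[OF le] T_fin by (intro psubset_card_mono) auto
      then show ?thesis
        using False False' by (simp add: rk_def)
    qed
  qed
  ultimately have "card V \<le> \<alpha> + (p - 1) * k"
    using equivariant_label_rank_bound[of p V s rk] p2 V by blast
  \<comment> \<open>This undoes the truncated subtraction in \<open>\<alpha>\<close>.\<close>
  moreover have "ecd p H \<le> card V"
    using ecd_attained[OF H, of p] V by (metis V_def card_mono)
  ultimately show ?thesis
    by (simp add: \<alpha>_def)
qed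

section \<open>All \<open>r\<close>, and the chromatic number\<close>

lemma kneser_bound:
  fixes H :: "'a hypergraph"
  assumes "r \<ge> 2" "hypergraph H" "proper_coloring (kneser_hypergraph r H) k c"
  shows "ecd r H \<le> (r - 1) * k"
  using assms
\<comment> \<open>The hypergraph varies because the product step applies the bounds for the factors
  to \<open>F\<close> and to induced subhypergraphs.\<close>
proof (induction r arbitrary: H k c rule: less_induct)
  case (less r)
  show ?case
  proof (cases "prime r")
    case True
    then show ?thesis
      using less.prems by (intro kneser_bound_prime)
  next
    case False
    then obtain a b where ab: "r = a * b" "a \<noteq> 1" "b \<noteq> 1"
      using prime_product[of r] less.prems(1) unfolding prime_nat_iff dvd_def
      by (metis One_nat_def Suc_1 less_eq_Suc_le mult.right_neutral nat_mult_eq_cancel_disj not_less_zero)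
    then have "a \<noteq> 0" "b \<noteq> 0"
      using less.prems(1) by (intro notI, simp)+
    then have "a \<ge> 2" "b \<ge> 2"
      using ab(2,3) by simp_all
    then have "a < r" "b < r"
      by (simp_all add: ab)
    then show ?thesis
      unfolding ab(1) using less.prems \<open>a \<ge> 2\<close> \<open>b \<ge> 2\<close>
      by (intro kneser_bound_mult less.IH) (auto simp: ab)
  qed
qed

theorem theorem1:
  fixes H :: "'a hypergraph" and r :: nat
  assumes "hypergraph H"
    and "r \<ge> 2"
  shows "int (chromatic_number (kneser_hypergraph r H)) \<ge> \<lceil>real (ecd r H) / (real r - 1)\<rceil>"
proof -
  let ?k = "chromatic_number (kneser_hypergraph r H)"
  have "\<exists>c. proper_coloring (kneser_hypergraph r H) ?k c"
    unfolding chromatic_number_def using kneser_hypergraph_colorable[OF assms] by (rule LeastI_ex)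
  then have "ecd r H \<le> (r - 1) * ?k"
    using kneser_bound assms by blast
  then have "real (ecd r H) \<le> real ((r - 1) * ?k)"
    by (simp only: of_nat_le_iff)
  then have "real (ecd r H) / (real r - 1) \<le> real ?k"
    using assms(2) by (simp add: divide_le_eq of_nat_diff mult.commute)
  then show ?thesis
    by (simp add: ceiling_le_iff)
qed

end
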